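(* Let $B,E\in C^1(\mathbb{R}^3;\mathbb{R}^3)$ with $|B(0)|>0$ independent of $\varepsilon$, and let $T>0$ be fixed. For $\varepsilon\in(0,1]$ let $(x(t),v(t))$ be the solution of $$\dot x=\varepsilon v,\quad \dot v=v\times B(\varepsilon x)+\varepsilon E(x),\quad 0<t\le \frac T\varepsilon,\qquad x(0)=x_0,\ v(0)=v_0,$$ and let $(x^n,v^n)$ be the numerical solution, with $x^0=x_0$, $v^0=v_0$, of the scheme S1-AVF $$x^{n+1}=x^{n}+\varepsilon h\,e^{h\widehat B(\varepsilon x^n)}v^{n}+\frac{h^2\varepsilon^2}{2}\int_0^1E\big(\rho x^n+(1-\rho)x^{n+1}\big)\,d\rho,$$ $$v^{n+1}=e^{h\widehat B(\varepsilon x^n)}v^{n}+h\varepsilon\int_0^1E\big(\rho x^n+(1-\rho)x^{n+1}\big)\,d\rho,$$ up to time $T/\varepsilon$, with $t_n=nh$. Then there exists a constant $N_0>0$ independent of $\varepsilon$ such that, when the time step is $h=\frac{T_0}{N}$ with an integer $N\ge N_0$, the following error bounds hold for $m_0>0$ arbitrarily large: $$|x^n-x(t_n)|\lesssim \varepsilon h+N^{-m_0},\qquad |v_\parallel^n-v_\parallel(t_n)|\lesssim \varepsilon h+N^{-m_0},\qquad 0\le t_n\le \frac T\varepsilon .$$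
   Context: For $B=(b_1,b_2,b_3)^\top$, $$\widehat B(y)=\begin{pmatrix}0&b_3(y)&-b_2(y)\\ -b_3(y)&0&b_1(y)\\ b_2(y)&-b_1(y)&0\end{pmatrix},$$ so that $\widehat B(y)v=v\times B(y)$. $E=-\nabla U$ for a scalar potential $U$. The initial data $x_0,v_0\in\mathbb{R}^3$ are given. $T_0>0$ denotes the single period of the periodic flow $t\mapsto e^{t\widehat B(0)}$ (i.e. $T_0=2\pi/|B(0)|$). The notation $a\lesssim b$ means $a\le Cb$ with a generic constant $C>0$ independent of $h$, $n$ and $\varepsilon$ (here $C$ may depend on $m_0$). The components of the exact and numerical velocities parallel to the magnetic field are $$v_\parallel(t)=\frac{B(\varepsilon x(t))}{|B(\varepsilon x(t))|}\Big(\frac{B(\varepsilon x(t))}{|B(\varepsilon x(t))|}\cdot v(t)\Big),\qquad v_\parallel^n=\frac{B(\varepsilon x^n)}{|B(\varepsilon x^n)|}\Big(\frac{B(\varepsilon x^n)}{|B(\varepsilon x^n)|}\cdot v^n\Big).$$ Standing bound: the exact solution exists on $[0,T/\varepsilon]$ and satisfies $\|x\|_{L^\infty(0,T/\varepsilon)}+\|v\|_{L^\infty(0,T/\varepsilon)}\lesssim1$, uniformly in $\varepsilon\in(0,1]$.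
   Formalization: The numerical solution of the implicit scheme is taken on the branch with |x^{n+1}-x^n| ≤ r for a fixed arbitrary r>0 (existence is proved; other roots violate the bound), and the v_∥ bound assumes B(εx(t)) ≠ 0 for all ε in (0,1] and 0≤t≤T/ε, so that v_∥ is defined. *)

theory Defs
  imports "HOL-Analysis.Analysis"
begin

definition C1 :: "('a::real_normed_vector \<Rightarrow> 'b::real_normed_vector) \<Rightarrow> bool" where
  "C1 f \<longleftrightarrow> (\<exists>f' :: 'a \<Rightarrow> 'a \<Rightarrow>\<^sub>L 'b.
     (\<forall>y. (f has_derivative blinfun_apply (f' y)) (at y)) \<and> continuous_on UNIV f')"

definition hat :: "real^3 \<Rightarrow> real^3^3" where
  "hat b = vector [vector [0, b $ 3, - b $ 2],
                   vector [- b $ 3, 0, b $ 1],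
                   vector [b $ 2, - b $ 1, 0]]"

lemma hat_mult_vec: "hat b *v w = cross3 w b"
  by (simp add: hat_def cross3_def vec_eq_iff matrix_vector_mult_def forall_3 sum_3 algebra_simps)

(* The library's exp is not available here: multiplication on real^'n^'n is componentwise,
   the matrix product being **. *)
definition mat_exp :: "real^'n^'n \<Rightarrow> real^'n^'n" where
  "mat_exp A = (\<Sum>k. (1 / fact k) *\<^sub>R (((**) A) ^^ k) (mat 1))"

definition gyro_period :: "(real^3 \<Rightarrow> real^3) \<Rightarrow> real" where
  "gyro_period B = 2 * pi / norm (B 0)"

definition particle_solution ::
    "(real^3 \<Rightarrow> real^3) \<Rightarrow> (real^3 \<Rightarrow> real^3) \<Rightarrow> real \<Rightarrow> real \<Rightarrow> real^3 \<Rightarrow> real^3 \<Rightarrow>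
     (real \<Rightarrow> real^3) \<Rightarrow> (real \<Rightarrow> real^3) \<Rightarrow> bool" where
  "particle_solution B E T \<epsilon> x0 v0 x v \<longleftrightarrow>
     x 0 = x0 \<and> v 0 = v0 \<and>
     continuous_on {0..T/\<epsilon>} x \<and> continuous_on {0..T/\<epsilon>} v \<and>
     (\<forall>t\<in>{0<..T/\<epsilon>}.
        (x has_vector_derivative \<epsilon> *\<^sub>R v t) (at t within {0..T/\<epsilon>}) \<and>
        (v has_vector_derivative cross3 (v t) (B (\<epsilon> *\<^sub>R x t)) + \<epsilon> *\<^sub>R E (x t))
          (at t within {0..T/\<epsilon>}))"

definition avg_field :: "(real^3 \<Rightarrow> real^3) \<Rightarrow> real^3 \<Rightarrow> real^3 \<Rightarrow> real^3" where
  "avg_field E y z = integral {0..1} (\<lambda>\<rho>. E (\<rho> *\<^sub>R y + (1 - \<rho>) *\<^sub>R z))"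

definition S1_AVF ::
    "(real^3 \<Rightarrow> real^3) \<Rightarrow> (real^3 \<Rightarrow> real^3) \<Rightarrow> real \<Rightarrow> real \<Rightarrow> real \<Rightarrow> real^3 \<Rightarrow> real^3 \<Rightarrow>
     (nat \<Rightarrow> real^3) \<Rightarrow> (nat \<Rightarrow> real^3) \<Rightarrow> bool" where
  "S1_AVF B E T \<epsilon> h x0 v0 xs vs \<longleftrightarrow>
     xs 0 = x0 \<and> vs 0 = v0 \<and>
     (\<forall>n. real (Suc n) * h \<le> T/\<epsilon> \<longrightarrow>
        xs (Suc n) = xs n + (\<epsilon> * h) *\<^sub>R (mat_exp (h *\<^sub>R hat (B (\<epsilon> *\<^sub>R xs n))) *v vs n)
                     + (h\<^sup>2 * \<epsilon>\<^sup>2 / 2) *\<^sub>R avg_field E (xs n) (xs (Suc n)) \<and>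
        vs (Suc n) = mat_exp (h *\<^sub>R hat (B (\<epsilon> *\<^sub>R xs n))) *v vs n
                     + (h * \<epsilon>) *\<^sub>R avg_field E (xs n) (xs (Suc n)))"

(* The scheme is implicit in the new position and E is only locally Lipschitz, so besides the
   root close to the old position the position equation may have spurious roots, whose distance
   tends to infinity as h or \<epsilon> tends to 0. The numerical solution is the branch that stays,
   in each single step, within some fixed distance r of the old position. *)
definition S1_AVF_numerical_solution ::
    "real \<Rightarrow> (real^3 \<Rightarrow> real^3) \<Rightarrow> (real^3 \<Rightarrow> real^3) \<Rightarrow> real \<Rightarrow> real \<Rightarrow> real \<Rightarrow> real^3 \<Rightarrow> real^3 \<Rightarrow>
     (nat \<Rightarrow> real^3) \<Rightarrow> (nat \<Rightarrow> real^3) \<Rightarrow> bool" where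
  "S1_AVF_numerical_solution r B E T \<epsilon> h x0 v0 xs vs \<longleftrightarrow>
     S1_AVF B E T \<epsilon> h x0 v0 xs vs \<and>
     (\<forall>n. real (Suc n) * h \<le> T/\<epsilon> \<longrightarrow> dist (xs n) (xs (Suc n)) \<le> r)"

definition v_par :: "(real^3 \<Rightarrow> real^3) \<Rightarrow> real \<Rightarrow> real^3 \<Rightarrow> real^3 \<Rightarrow> real^3" where
  "v_par B \<epsilon> y w =
     (let b = B (\<epsilon> *\<^sub>R y) /\<^sub>R norm (B (\<epsilon> *\<^sub>R y)) in (b \<bullet> w) *\<^sub>R b)"

end

theory Submission
  imports Defs
begin

text \<open>
  The scheme gives \<open>x\<^sup>n\<^sup>+\<^sup>1 = x\<^sup>n + \<epsilon>h v\<^sup>n\<^sup>+\<^sup>1 - \<epsilon>\<^sup>2h\<^sup>2/2 \<cdot> (average of E)\<close>, so the local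
  errors of the position and of the velocity are, up to \<open>O(\<epsilon>\<^sup>2h\<^sup>2)\<close>, equal to
  \<open>\<epsilon> (A - hR) v\<close> and \<open>\<epsilon> (A - h) E(x)\<close>, where \<open>R\<close> is the rotation over one step with the
  frozen field \<open>B(0)\<close> and \<open>A\<close> is the integral of that rotation over the step. They are only
  \<open>O(\<epsilon>h\<^sup>2)\<close>, but the two operators factor as \<open>G (R - 1)\<close> and \<open>G' (R - 1)\<close> with \<open>G, G' = O(h)\<close> as
  long as the step is not resonant with the gyration. Since \<open>v\<close> evolves by \<open>R\<close> up to \<open>O(\<epsilon>h)\<close>, the leading local errors
  are therefore telescoping, and adding \<open>\<epsilon>G v\<close> to the position error and subtracting
  \<open>\<epsilon>G' E(x)\<close> from the velocity error leaves a recursion with defect \<open>O(\<epsilon>\<^sup>2h\<^sup>2)\<close>. Gronwall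
  over \<open>O(1/(\<epsilon>h))\<close> steps yields the error \<open>O(\<epsilon>h)\<close>, even without the term in \<open>N\<close>.
\<close>

section \<open>Rotations about a constant field\<close>

unbundle cross3_syntax

lemma norm_cross_le: "norm (u \<times> w) \<le> norm u * norm w" for u w :: "real^3"
proof -
  have "(norm (u \<times> w))\<^sup>2 \<le> (norm u * norm w)\<^sup>2"
    using norm_cross_dot[of u w] zero_le_power2[of "u \<bullet> w"] by linarith
  then show ?thesis by (rule power2_le_imp_le) simp
qed

lemma cross_cross_cross: "((w \<times> b) \<times> b) \<times> b = - ((norm b)\<^sup>2 *\<^sub>R (w \<times> b))" for b w :: "real^3"
  unfolding power2_norm_eq_inner using exhaust_3 by (force simp: cross3_simps power2_eq_square)

definition rot :: "real^3 \<Rightarrow> real \<Rightarrow> real^3 \<Rightarrow> real^3" where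
  "rot b s w = w + (sin (s * norm b) / norm b) *\<^sub>R (w \<times> b)
     + ((1 - cos (s * norm b)) / (norm b)\<^sup>2) *\<^sub>R ((w \<times> b) \<times> b)"

lemma hat_cube: "A ** (A ** A) = - (s\<^sup>2 * (norm b)\<^sup>2) *\<^sub>R A" if "A = s *\<^sub>R hat b"
  unfolding that power2_norm_eq_inner hat_def matrix_matrix_mult_def
  by (simp add: vec_eq_iff forall_3 sum_3 inner_vec_def algebra_simps power2_eq_square)

lemma mat_exp_hat: "mat_exp (s *\<^sub>R hat b) *v w = rot b s w"
proof (cases "s * norm b = 0")
  case True
  have A0: "s *\<^sub>R hat b = 0"
    using True by (auto simp: hat_def vec_eq_iff forall_3)
  have "((**) (0::real^3^3) ^^ k) (mat 1) = (if k = 0 then mat 1 else 0)" for k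
    by (cases k) auto
  then have "mat_exp (0::real^3^3) = (\<Sum>k. if k = 0 then mat 1 else 0)"
    unfolding mat_exp_def by (intro suminf_cong) auto
  also have "\<dots> = mat 1"
    using sums_single[of 0 "\<lambda>_. mat 1 :: real^3^3"] by (simp add: sums_iff)
  finally have "mat_exp (s *\<^sub>R hat b) = mat 1" by (simp only: A0)
  then show ?thesis using True by (auto simp: rot_def)
next
  case False
  define \<theta> where "\<theta> = s * norm b"
  define A where "A = s *\<^sub>R hat b"
  have \<theta>: "\<theta> \<noteq> 0" using False by (simp add: \<theta>_def)
  have cube: "A ** (A ** A) = - (\<theta>\<^sup>2) *\<^sub>R A"
    using hat_cube[OF A_def] by (simp add: \<theta>_def power_mult_distrib)
  define d where "d k = (if k = 0 then 1 else 0 :: real)" for k :: nat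
  have pow: "(1 / fact k) *\<^sub>R ((**) A ^^ k) (mat 1) =
      d k *\<^sub>R mat 1 + ((sin_coeff k * \<theta> ^ k) / \<theta>) *\<^sub>R A + ((d k - cos_coeff k * \<theta> ^ k) / \<theta>\<^sup>2) *\<^sub>R (A ** A)" for k
  proof (induction k)
    case 0 then show ?case by (simp add: d_def)
  next
    case (Suc k)
    have "(1 / fact (Suc k)) *\<^sub>R ((**) A ^^ Suc k) (mat 1) = (1 / (Suc k)) *\<^sub>R (A ** ((1 / fact k) *\<^sub>R ((**) A ^^ k) (mat 1)))"
      by (simp add: matrix_scalar_ac scalar_matrix_assoc[symmetric] field_simps)
    also have "\<dots> = (1 / (Suc k)) *\<^sub>R (d k *\<^sub>R A + ((sin_coeff k * \<theta> ^ k) / \<theta>) *\<^sub>R (A ** A)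
        + ((d k - cos_coeff k * \<theta> ^ k) / \<theta>\<^sup>2) *\<^sub>R (- (\<theta>\<^sup>2) *\<^sub>R A))"
      unfolding Suc by (simp only: matrix_scalar_ac matrix_add_ldistrib cube matrix_mul_rid)
         (simp add: scalar_matrix_assoc[symmetric] cube)
    also have "\<dots> = ((sin_coeff (Suc k) * \<theta> ^ Suc k) / \<theta>) *\<^sub>R A + ((0 - cos_coeff (Suc k) * \<theta> ^ Suc k) / \<theta>\<^sup>2) *\<^sub>R (A ** A)"
    proof -
      define K where "K = real (Suc k)"
      have K: "K \<noteq> 0" by (simp add: K_def)
      have "((d k - cos_coeff k * \<theta> ^ k) / \<theta>\<^sup>2) *\<^sub>R (- (\<theta>\<^sup>2) *\<^sub>R A) = (cos_coeff k * \<theta> ^ k - d k) *\<^sub>R A"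
        using \<theta> by (simp add: scaleR_diff_left)
      then show ?thesis using \<theta> K unfolding sin_coeff_Suc cos_coeff_Suc K_def[symmetric]
        by (simp add: scaleR_add_right scaleR_diff_left scaleR_diff_right diff_divide_distrib power2_eq_square)
    qed
    finally show ?case by (simp add: d_def)
  qed
  have s1: "d sums 1"
    using sums_single[of 0 "\<lambda>_. 1::real"] by (simp add: d_def[abs_def])
  have "(\<lambda>k. (1 / fact k) *\<^sub>R ((**) A ^^ k) (mat 1)) sums
      (1 *\<^sub>R mat 1 + (sin \<theta> / \<theta>) *\<^sub>R A + ((1 - cos \<theta>) / \<theta>\<^sup>2) *\<^sub>R (A ** A))"
    unfolding pow
    by (intro sums_add sums_scaleR_left sums_divide sums_diff s1
         sin_converges[of \<theta>, unfolded real_scaleR_def] cos_converges[of \<theta>, unfolded real_scaleR_def])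
  then have "mat_exp A = 1 *\<^sub>R mat 1 + (sin \<theta> / \<theta>) *\<^sub>R A + ((1 - cos \<theta>) / \<theta>\<^sup>2) *\<^sub>R (A ** A)"
    unfolding mat_exp_def by (simp add: sums_iff)
  then have "mat_exp A *v w = w + (sin \<theta> / \<theta>) *\<^sub>R (A *v w) + ((1 - cos \<theta>) / \<theta>\<^sup>2) *\<^sub>R (A *v (A *v w))"
    by (simp add: matrix_vector_mult_add_rdistrib scaleR_matrix_vector_assoc[symmetric] matrix_vector_mul_assoc)
  also have "\<dots> = rot b s w"
    using False unfolding A_def rot_def
    by (simp add: scaleR_matrix_vector_assoc[symmetric] hat_mult_vec cross_mult_left \<theta>_def field_simps power2_eq_square)
  finally show ?thesis unfolding A_def .
qed

lemma norm_le_of_cross_ode: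
  fixes y b g :: "real \<Rightarrow> real^3"
  assumes h: "0 \<le> h" and cont: "continuous_on {0..h} y"
    and deriv: "\<And>s. 0 < s \<Longrightarrow> s < h \<Longrightarrow> (y has_vector_derivative y s \<times> b s + g s) (at s)"
    and g: "\<And>s. 0 < s \<Longrightarrow> s < h \<Longrightarrow> norm (g s) \<le> \<gamma>"
  shows "norm (y h) \<le> norm (y 0) + \<gamma> * h"
proof (cases "h = 0")
  case True then show ?thesis by simp
next
  case False
  with h have h0: "0 < h" by simp
  show ?thesis
  proof (rule field_le_epsilon)
    fix \<eta> :: real assume \<eta>: "0 < \<eta>"
    define \<phi> where "\<phi> s = sqrt (y s \<bullet> y s + \<eta>\<^sup>2)" for s
    have pos: "0 < y s \<bullet> y s + \<eta>\<^sup>2" for s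
      using \<eta> by (simp add: add_nonneg_pos)
    have d: "(\<phi> has_real_derivative (y s \<bullet> g s) / \<phi> s) (at s)" if "0 < s" "s < h" for s
    proof -
      have "((\<lambda>s. y s \<bullet> y s) has_derivative (\<lambda>t. y s \<bullet> (t *\<^sub>R (y s \<times> b s + g s)) + (t *\<^sub>R (y s \<times> b s + g s)) \<bullet> y s)) (at s)"
        using deriv[OF that] unfolding has_vector_derivative_def by (intro has_derivative_inner)
      moreover have "y s \<bullet> (t *\<^sub>R (y s \<times> b s + g s)) + (t *\<^sub>R (y s \<times> b s + g s)) \<bullet> y s = (2 * (y s \<bullet> g s)) * t" for t
        by (simp add: inner_add_right inner_add_left dot_cross_self inner_commute[of "g s"] algebra_simps)
      ultimately have "((\<lambda>s. y s \<bullet> y s) has_real_derivative 2 * (y s \<bullet> g s)) (at s)"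
        unfolding has_field_derivative_def by simp
      then have "((\<lambda>s. y s \<bullet> y s + \<eta>\<^sup>2) has_real_derivative 2 * (y s \<bullet> g s)) (at s)"
        by (auto intro!: derivative_eq_intros)
      from DERIV_chain2[OF DERIV_real_sqrt[OF pos] this]
      show ?thesis unfolding \<phi>_def[abs_def] by (simp add: field_simps)
    qed
    have "continuous_on {0..h} \<phi>"
      unfolding \<phi>_def[abs_def] by (intro continuous_intros cont)
    then obtain l z where z: "0 < z" "z < h" and l: "DERIV \<phi> z :> l" and e: "\<phi> h - \<phi> 0 = (h - 0) * l"
      using MVT[OF h0, of \<phi>] d real_differentiable_def by blast
    have "l = (y z \<bullet> g z) / \<phi> z"
      using DERIV_unique[OF l d[OF z]] .
    moreover have "y z \<bullet> g z \<le> \<gamma> * \<phi> z"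
    proof -
      have "norm (y z) \<le> \<phi> z"
        unfolding \<phi>_def norm_eq_sqrt_inner by simp
      moreover have "0 \<le> \<gamma>" using g[OF z] norm_ge_zero order_trans by blast
      ultimately have "norm (y z) * norm (g z) \<le> \<phi> z * \<gamma>"
        using g[OF z] pos by (intro mult_mono) (auto simp: \<phi>_def)
      then show ?thesis using norm_cauchy_schwarz[of "y z" "g z"] by (simp add: mult.commute)
    qed
    moreover have "0 < \<phi> z" using pos by (simp add: \<phi>_def)
    ultimately have "l \<le> \<gamma>" by (simp add: divide_le_eq)
    then have "h * l \<le> h * \<gamma>" using h0 by simp
    then have "\<phi> h \<le> \<phi> 0 + \<gamma> * h" using e by (simp add: mult.commute)
    moreover have "norm (y h) \<le> \<phi> h"
      unfolding \<phi>_def norm_eq_sqrt_inner by simp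
    moreover have "\<phi> 0 \<le> norm (y 0) + \<eta>"
      using sqrt_add_le_add_sqrt[of "y 0 \<bullet> y 0" "\<eta>\<^sup>2"] \<eta> by (simp add: \<phi>_def norm_eq_sqrt_inner)
    ultimately show "norm (y h) \<le> norm (y 0) + \<gamma> * h + \<eta>" by simp
  qed
qed

definition irot :: "real^3 \<Rightarrow> real \<Rightarrow> real^3 \<Rightarrow> real^3" where
  "irot b s w = s *\<^sub>R w + ((1 - cos (s * norm b)) / (norm b)\<^sup>2) *\<^sub>R (w \<times> b)
     + ((s - sin (s * norm b) / norm b) / (norm b)\<^sup>2) *\<^sub>R ((w \<times> b) \<times> b)"

lemma rot_0 [simp]: "rot b 0 w = w"
  by (simp add: rot_def)

lemma irot_0 [simp]: "irot b 0 w = 0"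
  by (simp add: irot_def)

lemma rot_add: "rot b s (u + w) = rot b s u + rot b s w"
  and rot_diff: "rot b s (u - w) = rot b s u - rot b s w"
  and rot_scaleR: "rot b s (c *\<^sub>R w) = c *\<^sub>R rot b s w"
  by (simp_all add: rot_def cross_add_left Cross3.left_diff_distrib cross_mult_left algebra_simps)

lemma rot_cross:
  "rot b s w \<times> b = cos (s * norm b) *\<^sub>R (w \<times> b) + (sin (s * norm b) / norm b) *\<^sub>R ((w \<times> b) \<times> b)"
  by (cases "b = 0")
     (simp_all add: rot_def cross_add_left cross_mult_left cross_cross_cross Cross3.left_diff_distrib scaleR_diff_left diff_divide_distrib)

lemma rot_deriv: "((\<lambda>s. rot b s w) has_vector_derivative rot b s w \<times> b) (at s within S)"
proof (cases "b = 0")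
  case True then show ?thesis by (simp add: rot_def)
next
  case False
  then show ?thesis
    unfolding rot_cross unfolding rot_def[abs_def]
    by (auto intro!: derivative_eq_intros simp: has_real_derivative_iff_has_vector_derivative[symmetric] field_simps power2_eq_square)
qed

lemma irot_deriv:
  assumes "b \<noteq> 0"
  shows "((\<lambda>s. irot b s w) has_vector_derivative rot b s w) (at s within S)"
  using assms unfolding rot_def irot_def[abs_def]
  by (auto intro!: derivative_eq_intros simp: has_real_derivative_iff_has_vector_derivative[symmetric] field_simps power2_eq_square)

lemma irot_cross:
  assumes "b \<noteq> 0"
  shows "irot b s w \<times> b + w = rot b s w"
  using assms
  by (simp add: rot_def irot_def cross_add_left cross_mult_left cross_cross_cross Cross3.left_diff_distrib scaleR_diff_left diff_divide_distrib)

lemma rot_continuous: "continuous_on S (\<lambda>s. rot b s w)"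
  using rot_deriv by (rule continuous_on_vector_derivative)

lemma irot_continuous: "b \<noteq> 0 \<Longrightarrow> continuous_on S (\<lambda>s. irot b s w)"
  using irot_deriv by (rule continuous_on_vector_derivative)

lemma norm_rot_le:
  assumes "0 \<le> s" shows "norm (rot b s w) \<le> norm w"
  using norm_le_of_cross_ode[OF assms rot_continuous, of b w "\<lambda>_. b" "\<lambda>_. 0" 0] rot_deriv by simp

lemma norm_irot_le:
  assumes "0 \<le> s" "b \<noteq> 0" shows "norm (irot b s w) \<le> s * norm w"
  using norm_le_of_cross_ode[OF assms(1) irot_continuous, of b w "\<lambda>_. b" "\<lambda>_. w" "norm w"] assms
    irot_deriv irot_cross by (simp add: mult.commute)

lemma norm_rot_diff_le:
  assumes "0 \<le> s" shows "norm (rot b s w - rot c s w) \<le> s * (norm w * norm (b - c))"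
proof -
  have "norm (rot b s w - rot c s w) \<le> norm (rot b 0 w - rot c 0 w) + (norm w * norm (b - c)) * s"
  proof (rule norm_le_of_cross_ode[OF assms, where b = "\<lambda>_. b" and g = "\<lambda>s. rot c s w \<times> (b - c)"])
    show "continuous_on {0..s} (\<lambda>s. rot b s w - rot c s w)"
      by (intro continuous_intros rot_continuous)
    fix t assume t: "0 < t" "t < s"
    have "rot b t w \<times> b - rot c t w \<times> c = (rot b t w - rot c t w) \<times> b + rot c t w \<times> (b - c)"
      by (simp add: Cross3.left_diff_distrib Cross3.right_diff_distrib)
    then show "((\<lambda>s. rot b s w - rot c s w) has_vector_derivative
        (rot b t w - rot c t w) \<times> b + rot c t w \<times> (b - c)) (at t)"
      using has_vector_derivative_diff[OF rot_deriv[of b w t] rot_deriv[of c w t]] by simp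
    have "norm (rot c t w \<times> (b - c)) \<le> norm (rot c t w) * norm (b - c)" by (rule norm_cross_le)
    also have "\<dots> \<le> norm w * norm (b - c)" using t by (intro mult_right_mono norm_rot_le) auto
    finally show "norm (rot c t w \<times> (b - c)) \<le> norm w * norm (b - c)" .
  qed
  then show ?thesis by (simp add: mult.commute)
qed

text \<open>With \<open>H = (\<lambda>w. w \<times> b)\<close> and \<open>\<theta> = h |b|\<close>, the operators \<open>irot - h rot\<close> and \<open>irot - h\<close> equal \<open>G (rot - 1)\<close> on the
  plane orthogonal to \<open>b\<close>, where the inverse of \<open>rot - 1\<close> is \<open>-1/2 - (i/2) cot (\<theta>/2)\<close>, with \<open>i\<close>
  standing for \<open>H/|b|\<close>. Working this out gives the coefficients below, \<open>\<sigma> = 1\<close> for the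
  first and \<open>\<sigma> = -1\<close> for the second operator.\<close>

definition gyr :: "real \<Rightarrow> real^3 \<Rightarrow> real \<Rightarrow> real^3 \<Rightarrow> real^3" where
  "gyr \<sigma> b h w = (\<sigma> * h / (2 * (norm b)\<^sup>2)) *\<^sub>R ((w \<times> b) \<times> b)
     + ((h * sin (h * norm b) / (2 * (1 - cos (h * norm b))) - 1 / norm b) / norm b) *\<^sub>R (w \<times> b)"

lemma gyr_diff: "gyr \<sigma> b h (u - w) = gyr \<sigma> b h u - gyr \<sigma> b h w"
  by (simp add: gyr_def Cross3.left_diff_distrib algebra_simps)

lemma gyr_coeff_bound:
  fixes h \<beta> :: real
  assumes "0 < h" "0 < \<beta>" "h * \<beta> \<le> 2"
  shows "\<bar>h * sin (h * \<beta>) / (2 * (1 - cos (h * \<beta>))) - 1 / \<beta>\<bar> \<le> h" and "cos (h * \<beta>) \<noteq> 1"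
proof -
  define y where "y = h * \<beta> / 2"
  have y: "0 < y" "y \<le> 1" "h * \<beta> = 2 * y" using assms by (auto simp: y_def)
  have s3: "\<bar>sin y - y\<bar> \<le> y ^ 3 / 6" 
    using Maclaurin_sin_bound[of y 3] y by (simp add: numeral_3_eq_3 sin_coeff_def fact_numeral field_simps)
  have "y ^ 3 \<le> y" using y by (simp add: power_le_one numeral_3_eq_3 mult_le_one)
  then have sy: "y / 2 \<le> sin y" using s3 y by linarith
  have c: "\<bar>cos y - 1\<bar> \<le> y\<^sup>2 / 2"
  proof -
    have "cos y = 1 - 2 * (sin (y/2))\<^sup>2" using cos_double_sin[of "y/2"] by simp
    moreover have "(sin (y/2))\<^sup>2 \<le> (y/2)\<^sup>2"
      using abs_sin_x_le_abs_x[of "y/2"] by (simp add: abs_le_square_iff[symmetric])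
    ultimately show ?thesis by (simp add: power_divide)
  qed
  have c2: "1 - cos (h * \<beta>) = 2 * (sin y)\<^sup>2" using cos_double_sin[of y] y by simp
  have s2: "sin (h * \<beta>) = 2 * sin y * cos y" using sin_double[of y] y by simp
  have sp: "0 < sin y" using sy y by linarith
  then show "cos (h * \<beta>) \<noteq> 1" using c2 by auto
  have "h * sin (h * \<beta>) / (2 * (1 - cos (h * \<beta>))) - 1 / \<beta> = (y * cos y - sin y) / (sin y * \<beta>)"
    unfolding c2 s2 using sp assms y by (simp add: field_simps power2_eq_square)
  also have "\<bar>\<dots>\<bar> \<le> h"
  proof -
    have "y * cos y - sin y = y * (cos y - 1) - (sin y - y)" by (simp add: algebra_simps)
    then have "\<bar>y * cos y - sin y\<bar> \<le> y * \<bar>cos y - 1\<bar> + \<bar>sin y - y\<bar>"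
      using y by (metis abs_mult abs_of_pos abs_triangle_ineq4)
    also have "\<dots> \<le> y * (y\<^sup>2 / 2) + y ^ 3 / 6" using s3 c y by (intro add_mono mult_left_mono) auto
    also have "\<dots> \<le> y * y\<^sup>2" using y by (simp add: power2_eq_square power3_eq_cube)
    also have "\<dots> \<le> y * y" using y by (simp add: power2_eq_square mult_le_one mult_left_le)
    also have "\<dots> \<le> sin y * (2 * y)" using sy y by simp
    finally have "\<bar>y * cos y - sin y\<bar> \<le> (sin y * \<beta>) * h" using y by (simp add: mult.assoc mult.commute[of \<beta>])
    then show ?thesis using sp assms by (simp add: abs_divide abs_mult divide_le_eq mult.commute)
  qed
  finally show "\<bar>h * sin (h * \<beta>) / (2 * (1 - cos (h * \<beta>))) - 1 / \<beta>\<bar> \<le> h" .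
qed

lemma norm_gyr_le:
  assumes "0 < h" "b \<noteq> 0" "h * norm b \<le> 2" "\<bar>\<sigma>\<bar> = 1"
  shows "norm (gyr \<sigma> b h w) \<le> 2 * h * norm w"
proof -
  define k where "k = h * sin (h * norm b) / (2 * (1 - cos (h * norm b))) - 1 / norm b"
  have k: "\<bar>k\<bar> \<le> h" using gyr_coeff_bound[of h "norm b"] assms by (simp add: k_def)
  have n1: "norm (w \<times> b) \<le> norm w * norm b" by (rule norm_cross_le)
  have n2: "norm ((w \<times> b) \<times> b) \<le> norm w * norm b * norm b"
    using norm_cross_le[of "w \<times> b" b] n1 by (meson mult_right_mono norm_ge_zero order_trans)
  have "norm (gyr \<sigma> b h w) \<le> \<bar>\<sigma> * h / (2 * (norm b)\<^sup>2)\<bar> * norm ((w \<times> b) \<times> b) + \<bar>k / norm b\<bar> * norm (w \<times> b)"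
    unfolding gyr_def k_def by (metis norm_scaleR norm_triangle_ineq)
  also have "\<dots> \<le> (h / (2 * (norm b)\<^sup>2)) * (norm w * norm b * norm b) + (h / norm b) * (norm w * norm b)"
    using n1 n2 k assms by (intro add_mono mult_mono) (auto simp: abs_mult divide_right_mono)
  also have "\<dots> \<le> 2 * h * norm w" using assms by (simp add: field_simps power2_eq_square)
  finally show ?thesis .
qed

lemma gyr_rot_coeffs:
  fixes h \<beta> :: real
  assumes \<beta>: "0 < \<beta>" and c: "cos (h * \<beta>) \<noteq> 1"
  defines "k \<equiv> (h * sin (h * \<beta>) / (2 * (1 - cos (h * \<beta>))) - 1 / \<beta>) / \<beta>"
  shows "\<sigma> * h / (2 * \<beta>\<^sup>2) * (- \<beta>\<^sup>2 * (sin (h * \<beta>) / \<beta>)) - k * (\<beta>\<^sup>2 * ((1 - cos (h * \<beta>)) / \<beta>\<^sup>2))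
      = (1 - cos (h * \<beta>)) / \<beta>\<^sup>2 - (1 + \<sigma>) / 2 * h * (sin (h * \<beta>) / \<beta>)" (is ?A)
    and "k * (sin (h * \<beta>) / \<beta>) - \<sigma> * h / (2 * \<beta>\<^sup>2) * (\<beta>\<^sup>2 * ((1 - cos (h * \<beta>)) / \<beta>\<^sup>2))
      = (h - sin (h * \<beta>) / \<beta>) / \<beta>\<^sup>2 - (1 + \<sigma>) / 2 * h * ((1 - cos (h * \<beta>)) / \<beta>\<^sup>2)" (is ?B)
proof -
  define S C where "S = sin (h * \<beta>)" and "C = cos (h * \<beta>)"
  have C: "1 - C \<noteq> 0" using c by (simp add: C_def)
  have SC: "S * S = (1 - C) * (1 + C)"
    using sin_cos_squared_add[of "h * \<beta>"] by (simp add: S_def C_def algebra_simps power2_eq_square)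
  have kS: "k * S = (h * (1 + C) / 2 - S / \<beta>) / \<beta>"
  proof -
    have "k * S = (h * (S * S) / (2 * (1 - C)) - S / \<beta>) / \<beta>" by (simp add: k_def S_def C_def field_simps)
    also have "\<dots> = (h * (1 + C) / 2 - S / \<beta>) / \<beta>"
    proof -
      define D where "D = 1 - C"
      have "D \<noteq> 0" using C by (simp add: D_def)
      then show ?thesis unfolding SC D_def[symmetric] by simp
    qed
    finally show ?thesis .
  qed
  have kC: "k * (1 - C) = (h * S / 2 - (1 - C) / \<beta>) / \<beta>"
    using C \<beta> unfolding k_def S_def[symmetric] C_def[symmetric] by (simp add: field_simps)
  have "\<sigma> * h / (2 * \<beta>\<^sup>2) * (- \<beta>\<^sup>2 * (S / \<beta>)) - k * (1 - C)
      = (1 - C) / \<beta>\<^sup>2 - (1 + \<sigma>) / 2 * h * (S / \<beta>)"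
    unfolding kC using \<beta> by (simp add: field_simps power2_eq_square)
  then show ?A using \<beta> by (simp add: S_def C_def)
  have "k * S / \<beta> - \<sigma> * h / (2 * \<beta>\<^sup>2) * (1 - C)
      = (h - S / \<beta>) / \<beta>\<^sup>2 - (1 + \<sigma>) / 2 * h * ((1 - C) / \<beta>\<^sup>2)"
    unfolding kS using \<beta> by (simp add: field_simps power2_eq_square)
  then show ?B using \<beta> by (simp add: S_def C_def)
qed

lemma gyr_rot:
  assumes b: "b \<noteq> 0" and c: "cos (h * norm b) \<noteq> 1"
  shows "gyr \<sigma> b h (rot b h w - w) = irot b h w - h *\<^sub>R (((1 - \<sigma>) / 2) *\<^sub>R w + ((1 + \<sigma>) / 2) *\<^sub>R rot b h w)"
    and "rot b h (gyr \<sigma> b h w) - gyr \<sigma> b h w = gyr \<sigma> b h (rot b h w - w)"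
proof -
  define \<beta> where "\<beta> = norm b"
  define k where "k = (h * sin (h * \<beta>) / (2 * (1 - cos (h * \<beta>))) - 1 / \<beta>) / \<beta>"
  define s where "s = sin (h * \<beta>) / \<beta>"
  define q where "q = (1 - cos (h * \<beta>)) / \<beta>\<^sup>2"
  define m where "m = \<sigma> * h / (2 * \<beta>\<^sup>2)"
  define p where "p = (1 + \<sigma>) / 2"
  define j where "j = (h - sin (h * \<beta>) / \<beta>) / \<beta>\<^sup>2"
  have \<beta>: "0 < \<beta>" using b by (simp add: \<beta>_def)
  define u where "u = w \<times> b"
  have cube: "((u \<times> b) \<times> b) = - (\<beta>\<^sup>2 *\<^sub>R u)" unfolding u_def \<beta>_def by (rule cross_cross_cross)
  have r: "rot b h w - w = s *\<^sub>R u + q *\<^sub>R (u \<times> b)"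
    by (simp add: rot_def s_def q_def \<beta>_def u_def)
  have co: "m * (- \<beta>\<^sup>2 * s) - k * (\<beta>\<^sup>2 * q) = q - p * h * s"
    "k * s - m * (\<beta>\<^sup>2 * q) = j - p * h * q"
    using gyr_rot_coeffs[OF \<beta>, of h \<sigma>] c
    unfolding k_def s_def q_def m_def p_def j_def \<beta>_def by auto
  have g: "gyr \<sigma> b h z = m *\<^sub>R ((z \<times> b) \<times> b) + k *\<^sub>R (z \<times> b)" for z
    by (simp add: gyr_def m_def k_def \<beta>_def)
  have g1: "gyr \<sigma> b h (rot b h w - w) = (m * (- \<beta>\<^sup>2 * s) - k * (\<beta>\<^sup>2 * q)) *\<^sub>R u + (k * s - m * (\<beta>\<^sup>2 * q)) *\<^sub>R (u \<times> b)"
    unfolding g r by (simp add: cross_add_left cross_mult_left cube Cross3.left_diff_distrib algebra_simps)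
  also have "\<dots> = irot b h w - h *\<^sub>R ((1 - p) *\<^sub>R w + p *\<^sub>R rot b h w)"
  proof -
    have i: "irot b h w = h *\<^sub>R w + q *\<^sub>R u + j *\<^sub>R (u \<times> b)"
      by (simp add: irot_def q_def j_def \<beta>_def u_def)
    have "rot b h w = w + (s *\<^sub>R u + q *\<^sub>R (u \<times> b))" using r by (simp add: algebra_simps)
    then show ?thesis unfolding co i by (simp add: algebra_simps)
  qed
  finally show "gyr \<sigma> b h (rot b h w - w) = irot b h w - h *\<^sub>R (((1 - \<sigma>) / 2) *\<^sub>R w + ((1 + \<sigma>) / 2) *\<^sub>R rot b h w)"
    by (simp add: p_def field_simps)
  have "rot b h z - z = s *\<^sub>R (z \<times> b) + q *\<^sub>R ((z \<times> b) \<times> b)" for z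
    by (simp add: rot_def s_def q_def \<beta>_def)
  then have "rot b h (gyr \<sigma> b h w) - gyr \<sigma> b h w = s *\<^sub>R (gyr \<sigma> b h w \<times> b) + q *\<^sub>R ((gyr \<sigma> b h w \<times> b) \<times> b)" .
  then show "rot b h (gyr \<sigma> b h w) - gyr \<sigma> b h w = gyr \<sigma> b h (rot b h w - w)"
    unfolding g1 unfolding g u_def[symmetric] by (simp add: cross_add_left cross_mult_left cube Cross3.left_diff_distrib algebra_simps)
qed

section \<open>Local errors along the exact flow\<close>

locale gyro_flow =
  fixes B E :: "real^3 \<Rightarrow> real^3" and x v :: "real \<Rightarrow> real^3" and \<epsilon> S K r \<Lambda> :: real
  assumes eps: "0 < \<epsilon>" "\<epsilon> \<le> 1"
    and r: "0 < r"
    and \<Lambda>: "K + 1 + r \<le> \<Lambda>" "1 \<le> \<Lambda>"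
    and B_lip: "\<And>y z. norm y \<le> K + 1 + r \<Longrightarrow> norm z \<le> K + 1 + r \<Longrightarrow> norm (B y - B z) \<le> \<Lambda> * norm (y - z)"
    and E_lip: "\<And>y z. norm y \<le> K + 1 + r \<Longrightarrow> norm z \<le> K + 1 + r \<Longrightarrow> norm (E y - E z) \<le> \<Lambda> * norm (y - z)"
    and E_bound: "\<And>y. norm y \<le> K + 1 + r \<Longrightarrow> norm (E y) \<le> \<Lambda>"
    and E_cont: "continuous_on UNIV E"
    and B0: "B 0 \<noteq> 0"
    and x_cont: "continuous_on {0..S} x" and v_cont: "continuous_on {0..S} v"
    and x_deriv: "\<And>t. 0 < t \<Longrightarrow> t < S \<Longrightarrow> (x has_vector_derivative \<epsilon> *\<^sub>R v t) (at t)"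
    and v_deriv: "\<And>t. 0 < t \<Longrightarrow> t < S \<Longrightarrow>
      (v has_vector_derivative v t \<times> B (\<epsilon> *\<^sub>R x t) + \<epsilon> *\<^sub>R E (x t)) (at t)"
    and x_bound: "\<And>t. 0 \<le> t \<Longrightarrow> t \<le> S \<Longrightarrow> norm (x t) \<le> K"
    and v_bound: "\<And>t. 0 \<le> t \<Longrightarrow> t \<le> S \<Longrightarrow> norm (v t) \<le> K"
begin

lemma v_le: "0 \<le> t \<Longrightarrow> t \<le> S \<Longrightarrow> norm (v t) \<le> \<Lambda>"
  and x_le: "0 \<le> t \<Longrightarrow> t \<le> S \<Longrightarrow> norm (x t) \<le> \<Lambda>"
  and x_ball: "0 \<le> t \<Longrightarrow> t \<le> S \<Longrightarrow> norm (x t) \<le> K + 1 + r"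
  using v_bound[of t] x_bound[of t] \<Lambda> r by auto

lemma E_x_le: "0 \<le> t \<Longrightarrow> t \<le> S \<Longrightarrow> norm (E (x t)) \<le> \<Lambda>"
  using E_bound x_ball by blast

lemma scaled_ball: "norm y \<le> K + 1 + r \<Longrightarrow> norm (\<epsilon> *\<^sub>R y) \<le> K + 1 + r"
  using eps mult_left_le_one_le[of "norm y" \<epsilon>] by simp

lemma B_lip_scaled:
  assumes "norm y \<le> K + 1 + r" "norm z \<le> K + 1 + r"
  shows "norm (B (\<epsilon> *\<^sub>R y) - B (\<epsilon> *\<^sub>R z)) \<le> \<Lambda> * (\<epsilon> * norm (y - z))"
proof -
  have "norm (B (\<epsilon> *\<^sub>R y) - B (\<epsilon> *\<^sub>R z)) \<le> \<Lambda> * norm (\<epsilon> *\<^sub>R y - \<epsilon> *\<^sub>R z)"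
    using assms scaled_ball by (intro B_lip)
  then show ?thesis using eps by (simp add: scaleR_diff_right[symmetric])
qed

lemma B_near_B0:
  assumes "0 \<le> t" "t \<le> S"
  shows "norm (B (\<epsilon> *\<^sub>R x t) - B 0) \<le> \<epsilon> * \<Lambda>\<^sup>2"
proof -
  have "norm (0::real^3) \<le> K + 1 + r" using x_ball[OF assms] norm_ge_zero order_trans norm_zero by metis
  then have "norm (B (\<epsilon> *\<^sub>R x t) - B 0) \<le> \<Lambda> * (\<epsilon> * norm (x t))"
    using B_lip_scaled[of "x t" 0] x_ball[OF assms] by simp
  also have "\<dots> \<le> \<Lambda> * (\<epsilon> * \<Lambda>)" using x_le[OF assms] \<Lambda> eps by (intro mult_left_mono) auto
  finally show ?thesis by (simp add: power2_eq_square algebra_simps)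
qed

lemma shifted_cont:
  assumes "0 \<le> t" "t + h \<le> S"
  shows "continuous_on {0..h} (\<lambda>s. x (t + s))" "continuous_on {0..h} (\<lambda>s. v (t + s))"
  using assms
  by (auto intro!: continuous_on_compose2[OF x_cont] continuous_on_compose2[OF v_cont] continuous_intros)

lemma shifted_deriv:
  assumes "0 \<le> t" "t + h \<le> S" "0 < s" "s < h"
  shows "((\<lambda>s. x (t + s)) has_vector_derivative \<epsilon> *\<^sub>R v (t + s)) (at s)"
    and "((\<lambda>s. v (t + s)) has_vector_derivative
      v (t + s) \<times> B (\<epsilon> *\<^sub>R x (t + s)) + \<epsilon> *\<^sub>R E (x (t + s))) (at s)"
proof -
  have s: "((\<lambda>s. t + s) has_vector_derivative 1) (at s)"
    by (auto intro!: derivative_eq_intros)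
  have b: "0 < t + s" "t + s < S" using assms by auto
  show "((\<lambda>s. x (t + s)) has_vector_derivative \<epsilon> *\<^sub>R v (t + s)) (at s)"
    using vector_diff_chain_at[OF s x_deriv[OF b]] by (simp add: o_def)
  show "((\<lambda>s. v (t + s)) has_vector_derivative
      v (t + s) \<times> B (\<epsilon> *\<^sub>R x (t + s)) + \<epsilon> *\<^sub>R E (x (t + s))) (at s)"
    using vector_diff_chain_at[OF s v_deriv[OF b]] by (simp add: o_def)
qed

lemma x_increment:
  assumes "0 \<le> t" "0 \<le> h" "t + h \<le> S"
  shows "norm (x (t + h) - x t) \<le> \<epsilon> * \<Lambda> * h"
proof -
  have "norm (x (t + h) - x t) \<le> norm (x (t + 0) - x t) + (\<epsilon> * \<Lambda>) * h"
  proof (rule norm_le_of_cross_ode[OF assms(2), where b = "\<lambda>_. 0" and g = "\<lambda>s. \<epsilon> *\<^sub>R v (t + s)"])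
    show "continuous_on {0..h} (\<lambda>s. x (t + s) - x t)"
      by (intro continuous_intros shifted_cont assms)
    fix s assume s: "0 < s" "s < h"
    show "((\<lambda>s. x (t + s) - x t) has_vector_derivative (x (t + s) - x t) \<times> 0 + \<epsilon> *\<^sub>R v (t + s)) (at s)"
      using shifted_deriv(1)[OF assms(1,3) s] by (auto intro!: derivative_eq_intros)
    show "norm (\<epsilon> *\<^sub>R v (t + s)) \<le> \<epsilon> * \<Lambda>"
      using v_le[of "t + s"] s assms eps by simp
  qed
  then show ?thesis by simp
qed

lemma v_free_rotation:
  assumes "0 \<le> t" "0 \<le> h" "t + h \<le> S"
  shows "norm (v (t + h) - rot (B 0) h (v t)) \<le> 2 * \<Lambda>^3 * \<epsilon> * h"
proof -
  have "norm (v (t + h) - rot (B 0) h (v t)) \<le> norm (v (t + 0) - rot (B 0) 0 (v t)) + (2 * \<Lambda>^3 * \<epsilon>) * h"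
  proof (rule norm_le_of_cross_ode[OF assms(2), where b = "\<lambda>s. B (\<epsilon> *\<^sub>R x (t + s))"
        and g = "\<lambda>s. rot (B 0) s (v t) \<times> (B (\<epsilon> *\<^sub>R x (t + s)) - B 0) + \<epsilon> *\<^sub>R E (x (t + s))"])
    show "continuous_on {0..h} (\<lambda>s. v (t + s) - rot (B 0) s (v t))"
      by (intro continuous_intros shifted_cont rot_continuous assms)
    fix s assume s: "0 < s" "s < h"
    have ts: "0 \<le> t + s" "t + s \<le> S" using s assms by auto
    show "((\<lambda>s. v (t + s) - rot (B 0) s (v t)) has_vector_derivative
        (v (t + s) - rot (B 0) s (v t)) \<times> B (\<epsilon> *\<^sub>R x (t + s))
        + (rot (B 0) s (v t) \<times> (B (\<epsilon> *\<^sub>R x (t + s)) - B 0) + \<epsilon> *\<^sub>R E (x (t + s)))) (at s)"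
      using has_vector_derivative_diff[OF shifted_deriv(2)[OF assms(1,3) s] rot_deriv[of "B 0" "v t" s]]
      by (simp add: Cross3.left_diff_distrib Cross3.right_diff_distrib algebra_simps)
    have "norm (rot (B 0) s (v t)) \<le> \<Lambda>"
      using norm_rot_le[of s "B 0" "v t"] v_le[of t] s assms by auto
    then have "norm (rot (B 0) s (v t) \<times> (B (\<epsilon> *\<^sub>R x (t + s)) - B 0)) \<le> \<Lambda> * (\<epsilon> * \<Lambda>\<^sup>2)"
      using B_near_B0[OF ts] \<Lambda> by (intro order_trans[OF norm_cross_le] mult_mono) auto
    moreover have "norm (\<epsilon> *\<^sub>R E (x (t + s))) \<le> \<epsilon> * \<Lambda>^3"
    proof -
      have "\<Lambda> \<le> \<Lambda>^3" using \<Lambda> power_increasing[of 1 3 \<Lambda>] by simp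
      then show ?thesis using E_x_le[OF ts] eps by simp
    qed
    ultimately show "norm (rot (B 0) s (v t) \<times> (B (\<epsilon> *\<^sub>R x (t + s)) - B 0) + \<epsilon> *\<^sub>R E (x (t + s))) \<le> 2 * \<Lambda>^3 * \<epsilon>"
      by (intro order_trans[OF norm_triangle_ineq]) (simp add: power2_eq_square power3_eq_cube algebra_simps)
  qed
  then show ?thesis by simp
qed

lemma x_free_rotation:
  assumes "0 \<le> t" "0 \<le> h" "t + h \<le> S"
  shows "norm (x (t + h) - x t - \<epsilon> *\<^sub>R irot (B 0) h (v t)) \<le> 2 * \<Lambda>^3 * \<epsilon>\<^sup>2 * h\<^sup>2"
proof -
  have "norm (x (t + h) - x t - \<epsilon> *\<^sub>R irot (B 0) h (v t))
      \<le> norm (x (t + 0) - x t - \<epsilon> *\<^sub>R irot (B 0) 0 (v t)) + (\<epsilon> * (2 * \<Lambda>^3 * \<epsilon> * h)) * h"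
  proof (rule norm_le_of_cross_ode[OF assms(2), where b = "\<lambda>s. 0"
        and g = "\<lambda>s. \<epsilon> *\<^sub>R (v (t + s) - rot (B 0) s (v t))"])
    show "continuous_on {0..h} (\<lambda>s. x (t + s) - x t - \<epsilon> *\<^sub>R irot (B 0) s (v t))"
      by (intro continuous_intros shifted_cont irot_continuous assms B0)
    fix s assume s: "0 < s" "s < h"
    show "((\<lambda>s. x (t + s) - x t - \<epsilon> *\<^sub>R irot (B 0) s (v t)) has_vector_derivative
        (x (t + s) - x t - \<epsilon> *\<^sub>R irot (B 0) s (v t)) \<times> 0 + \<epsilon> *\<^sub>R (v (t + s) - rot (B 0) s (v t))) (at s)"
      using shifted_deriv(1)[OF assms(1,3) s] irot_deriv[OF B0, of "v t" s]
      by (auto intro!: derivative_eq_intros simp: algebra_simps)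
    have "norm (v (t + s) - rot (B 0) s (v t)) \<le> 2 * \<Lambda>^3 * \<epsilon> * s"
      using v_free_rotation[of t s] s assms by simp
    also have "\<dots> \<le> 2 * \<Lambda>^3 * \<epsilon> * h" using s \<Lambda> eps by (intro mult_left_mono) auto
    finally show "norm (\<epsilon> *\<^sub>R (v (t + s) - rot (B 0) s (v t))) \<le> \<epsilon> * (2 * \<Lambda>^3 * \<epsilon> * h)"
      using eps by simp
  qed
  then show ?thesis by (simp add: power2_eq_square algebra_simps)
qed

lemma v_variation_of_constants:
  assumes "0 \<le> t" "0 \<le> h" "t + h \<le> S"
  shows "norm (v (t + h) - rot (B (\<epsilon> *\<^sub>R x t)) h (v t) - \<epsilon> *\<^sub>R irot (B 0) h (E (x t))) \<le> 3 * \<Lambda>^3 * \<epsilon>\<^sup>2 * h\<^sup>2"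
proof -
  define b where "b = B (\<epsilon> *\<^sub>R x t)"
  have t: "t \<le> S" using assms by simp
  have "norm (v (t + h) - rot b h (v t) - \<epsilon> *\<^sub>R irot (B 0) h (E (x t)))
      \<le> norm (v (t + 0) - rot b 0 (v t) - \<epsilon> *\<^sub>R irot (B 0) 0 (E (x t))) + (3 * \<Lambda>^3 * \<epsilon>\<^sup>2 * h) * h"
  proof (rule norm_le_of_cross_ode[OF assms(2), where b = "\<lambda>s. B (\<epsilon> *\<^sub>R x (t + s))"
        and g = "\<lambda>s. rot b s (v t) \<times> (B (\<epsilon> *\<^sub>R x (t + s)) - b)
          + \<epsilon> *\<^sub>R (irot (B 0) s (E (x t)) \<times> (B (\<epsilon> *\<^sub>R x (t + s)) - B 0)) + \<epsilon> *\<^sub>R (E (x (t + s)) - E (x t))"])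
    show "continuous_on {0..h} (\<lambda>s. v (t + s) - rot b s (v t) - \<epsilon> *\<^sub>R irot (B 0) s (E (x t)))"
      by (intro continuous_intros shifted_cont rot_continuous irot_continuous assms B0)
    fix s assume s: "0 < s" "s < h"
    have ts: "0 \<le> t + s" "t + s \<le> S" using s assms by auto
    have e: "rot (B 0) s (E (x t)) = irot (B 0) s (E (x t)) \<times> B 0 + E (x t)"
      using irot_cross[OF B0] by simp
    show "((\<lambda>s. v (t + s) - rot b s (v t) - \<epsilon> *\<^sub>R irot (B 0) s (E (x t))) has_vector_derivative
        (v (t + s) - rot b s (v t) - \<epsilon> *\<^sub>R irot (B 0) s (E (x t))) \<times> B (\<epsilon> *\<^sub>R x (t + s))
        + (rot b s (v t) \<times> (B (\<epsilon> *\<^sub>R x (t + s)) - b)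
          + \<epsilon> *\<^sub>R (irot (B 0) s (E (x t)) \<times> (B (\<epsilon> *\<^sub>R x (t + s)) - B 0)) + \<epsilon> *\<^sub>R (E (x (t + s)) - E (x t)))) (at s)"
      by (rule has_vector_derivative_eq_rhs[OF has_vector_derivative_diff[OF has_vector_derivative_diff[OF
            shifted_deriv(2)[OF assms(1,3) s] rot_deriv]
            has_vector_derivative_scaleR[OF DERIV_const irot_deriv[OF B0]]]])
         (simp add: e Cross3.left_diff_distrib Cross3.right_diff_distrib cross_add_left cross_mult_left algebra_simps)
    have inc: "norm (x (t + s) - x t) \<le> \<epsilon> * \<Lambda> * h"
    proof -
      have "norm (x (t + s) - x t) \<le> \<epsilon> * \<Lambda> * s" using x_increment[of t s] s assms by simp
      also have "\<dots> \<le> \<epsilon> * \<Lambda> * h" using s \<Lambda> eps by (intro mult_left_mono) auto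
      finally show ?thesis .
    qed
    have "norm (rot b s (v t)) \<le> \<Lambda>"
      using norm_rot_le[of s b "v t"] v_le[of t] s assms by auto
    moreover have "norm (B (\<epsilon> *\<^sub>R x (t + s)) - b) \<le> \<Lambda> * (\<epsilon> * (\<epsilon> * \<Lambda> * h))"
      unfolding b_def using inc \<Lambda> eps
      by (intro order_trans[OF B_lip_scaled[OF x_ball[OF ts] x_ball[OF assms(1) t]]] mult_left_mono) auto
    ultimately have 1: "norm (rot b s (v t) \<times> (B (\<epsilon> *\<^sub>R x (t + s)) - b)) \<le> \<Lambda> * (\<Lambda> * (\<epsilon> * (\<epsilon> * \<Lambda> * h)))"
      using \<Lambda> by (intro order_trans[OF norm_cross_le] mult_mono) auto
    have "norm (irot (B 0) s (E (x t))) \<le> h * \<Lambda>"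
      using E_x_le[of t] s assms by (intro order_trans[OF norm_irot_le[OF _ B0]] mult_mono) auto
    then have 2: "norm (\<epsilon> *\<^sub>R (irot (B 0) s (E (x t)) \<times> (B (\<epsilon> *\<^sub>R x (t + s)) - B 0))) \<le> \<epsilon> * ((h * \<Lambda>) * (\<epsilon> * \<Lambda>\<^sup>2))"
      using B_near_B0[OF ts] \<Lambda> eps assms
      by (simp only: norm_scaleR abs_of_pos, intro mult_left_mono order_trans[OF norm_cross_le] mult_mono) auto
    have "norm (E (x (t + s)) - E (x t)) \<le> \<Lambda> * (\<epsilon> * \<Lambda> * h)"
      using inc \<Lambda> by (intro order_trans[OF E_lip[OF x_ball[OF ts] x_ball[OF assms(1) t]]] mult_left_mono) auto
    also have "\<dots> \<le> \<Lambda> * (\<Lambda> * (\<epsilon> * \<Lambda> * h))"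
      using \<Lambda> eps assms mult_right_mono[of 1 \<Lambda> "\<epsilon> * \<Lambda> * h"] by (intro mult_left_mono) auto
    finally have 3: "norm (\<epsilon> *\<^sub>R (E (x (t + s)) - E (x t))) \<le> \<epsilon> * (\<Lambda> * (\<Lambda> * (\<epsilon> * \<Lambda> * h)))"
      using eps by simp
    show "norm (rot b s (v t) \<times> (B (\<epsilon> *\<^sub>R x (t + s)) - b)
          + \<epsilon> *\<^sub>R (irot (B 0) s (E (x t)) \<times> (B (\<epsilon> *\<^sub>R x (t + s)) - B 0)) + \<epsilon> *\<^sub>R (E (x (t + s)) - E (x t)))
          \<le> 3 * \<Lambda>^3 * \<epsilon>\<^sup>2 * h"
      by (rule order_trans[OF norm_triangle_le[OF add_mono[OF norm_triangle_le[OF add_mono[OF 1 2]] 3]]])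
         (simp add: power2_eq_square power3_eq_cube algebra_simps)
  qed
  then show ?thesis by (simp add: b_def power2_eq_square algebra_simps)
qed

lemma segment_ball:
  assumes "norm y \<le> K + 1 + r" "norm z \<le> K + 1 + r" "\<rho> \<in> {0..1}"
  shows "norm (\<rho> *\<^sub>R y + (1 - \<rho>) *\<^sub>R z) \<le> K + 1 + r"
  using assms convexD_alt[OF convex_cball, of y 0 "K + 1 + r" z "1 - \<rho>"] by simp

lemma avg_integrable: "(\<lambda>\<rho>. E (\<rho> *\<^sub>R y + (1 - \<rho>) *\<^sub>R z)) integrable_on {0..1}"
  by (intro integrable_continuous_real continuous_on_compose2[OF E_cont] continuous_intros) auto

lemma norm_avg_field_diff_le:
  assumes "norm y \<le> K + 1 + r" "norm z \<le> K + 1 + r" "norm z' \<le> K + 1 + r"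
  shows "norm (avg_field E y z - avg_field E y z') \<le> \<Lambda> * norm (z - z')"
proof -
  have "norm (integral {0..1} (\<lambda>\<rho>. E (\<rho> *\<^sub>R y + (1 - \<rho>) *\<^sub>R z) - E (\<rho> *\<^sub>R y + (1 - \<rho>) *\<^sub>R z')))
    \<le> \<Lambda> * norm (z - z') * (1 - 0)"
  proof (rule integral_bound)
    show "continuous_on {0..1} (\<lambda>\<rho>. E (\<rho> *\<^sub>R y + (1 - \<rho>) *\<^sub>R z) - E (\<rho> *\<^sub>R y + (1 - \<rho>) *\<^sub>R z'))"
      by (intro continuous_on_compose2[OF E_cont] continuous_intros) auto
    fix \<rho> :: real assume \<rho>: "\<rho> \<in> {0..1}"
    have "norm (E (\<rho> *\<^sub>R y + (1 - \<rho>) *\<^sub>R z) - E (\<rho> *\<^sub>R y + (1 - \<rho>) *\<^sub>R z'))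
      \<le> \<Lambda> * norm ((\<rho> *\<^sub>R y + (1 - \<rho>) *\<^sub>R z) - (\<rho> *\<^sub>R y + (1 - \<rho>) *\<^sub>R z'))"
      by (intro E_lip segment_ball assms \<rho>)
    also have "(\<rho> *\<^sub>R y + (1 - \<rho>) *\<^sub>R z) - (\<rho> *\<^sub>R y + (1 - \<rho>) *\<^sub>R z') = (1 - \<rho>) *\<^sub>R (z - z')"
      by (simp add: algebra_simps)
    also have "norm \<dots> \<le> norm (z - z')" using \<rho> by (simp add: mult_left_le_one_le)
    finally show "norm (E (\<rho> *\<^sub>R y + (1 - \<rho>) *\<^sub>R z) - E (\<rho> *\<^sub>R y + (1 - \<rho>) *\<^sub>R z')) \<le> \<Lambda> * norm (z - z')"
      using \<Lambda> by (simp add: mult_left_mono)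
  qed simp
  then show ?thesis unfolding avg_field_def using avg_integrable by (simp add: integral_diff)
qed

lemma avg_field_same: "avg_field E y y = E y"
  by (simp add: avg_field_def scaleR_add_left[symmetric])

lemma norm_avg_field_le:
  assumes "norm y \<le> K + 1 + r" "norm z \<le> K + 1 + r"
  shows "norm (avg_field E y z) \<le> \<Lambda>"
proof -
  have "norm (avg_field E y z) \<le> \<Lambda> * (1 - 0)" unfolding avg_field_def
  proof (rule integral_bound)
    show "continuous_on {0..1} (\<lambda>\<rho>. E (\<rho> *\<^sub>R y + (1 - \<rho>) *\<^sub>R z))"
      by (intro continuous_on_compose2[OF E_cont] continuous_intros) auto
  qed (auto intro!: E_bound segment_ball assms)
  then show ?thesis by simp
qed

section \<open>Error recursion for the scheme\<close>

definition step :: "real \<Rightarrow> (real^3) \<times> (real^3) \<Rightarrow> (real^3) \<times> (real^3) \<Rightarrow> bool" where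
  "step h p q \<longleftrightarrow>
     fst q = fst p + (\<epsilon> * h) *\<^sub>R rot (B (\<epsilon> *\<^sub>R fst p)) h (snd p)
             + (h\<^sup>2 * \<epsilon>\<^sup>2 / 2) *\<^sub>R avg_field E (fst p) (fst q) \<and>
     snd q = rot (B (\<epsilon> *\<^sub>R fst p)) h (snd p) + (h * \<epsilon>) *\<^sub>R avg_field E (fst p) (fst q) \<and>
     dist (fst p) (fst q) \<le> r"

definition x_err :: "real \<Rightarrow> real \<Rightarrow> real^3 \<Rightarrow> real^3" where
  "x_err h t X = X - x t + \<epsilon> *\<^sub>R gyr 1 (B 0) h (v t)"

definition v_err :: "real \<Rightarrow> real \<Rightarrow> real^3 \<Rightarrow> real^3" where
  "v_err h t V = V - v t - \<epsilon> *\<^sub>R gyr (- 1) (B 0) h (E (x t))"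

lemma norm_gyr_le_bound:
  assumes "0 < h" "h * norm (B 0) \<le> 2" "norm w \<le> \<Lambda>" "\<bar>\<sigma>\<bar> = 1"
  shows "norm (gyr \<sigma> (B 0) h w) \<le> 2 * h * \<Lambda>"
proof -
  have "norm (gyr \<sigma> (B 0) h w) \<le> 2 * h * norm w" using assms B0 by (intro norm_gyr_le) auto
  also have "\<dots> \<le> 2 * h * \<Lambda>" using assms by (intro mult_left_mono) auto
  finally show ?thesis .
qed

lemma x_err_close:
  assumes "0 < h" "h * norm (B 0) \<le> 2" "0 \<le> t" "t \<le> S"
  shows "norm (x_err h t X - (X - x t)) \<le> 2 * \<Lambda> * (\<epsilon> * h)"
proof -
  have "norm (gyr 1 (B 0) h (v t)) \<le> 2 * h * \<Lambda>"
    using assms v_le by (intro norm_gyr_le_bound) auto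
  then have "\<epsilon> * norm (gyr 1 (B 0) h (v t)) \<le> \<epsilon> * (2 * h * \<Lambda>)" using eps by simp
  then show ?thesis using eps by (simp add: x_err_def algebra_simps)
qed

lemma v_err_close:
  assumes "0 < h" "h * norm (B 0) \<le> 2" "0 \<le> t" "t \<le> S"
  shows "norm (v_err h t V - (V - v t)) \<le> 2 * \<Lambda> * (\<epsilon> * h)"
proof -
  have "norm (gyr (-1) (B 0) h (E (x t))) \<le> 2 * h * \<Lambda>"
    using assms E_x_le by (intro norm_gyr_le_bound) auto
  then have "\<epsilon> * norm (gyr (-1) (B 0) h (E (x t))) \<le> \<epsilon> * (2 * h * \<Lambda>)" using eps by simp
  then show ?thesis using eps by (simp add: v_err_def algebra_simps)
qed

lemma step_distance:
  assumes h: "0 < h" "h \<le> 1"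
    and X: "norm X \<le> K + 1" and V: "norm V \<le> K + 1" and st: "step h (X, V) (X', V')"
  shows "norm X' \<le> K + 1 + r" "norm (X' - X) \<le> 2 * \<Lambda> * (\<epsilon> * h)"
proof -
  have "dist X X' \<le> r" using st by (simp add: step_def)
  then show X': "norm X' \<le> K + 1 + r"
    using X norm_triangle_sub[of X' X] by (simp add: dist_norm norm_minus_commute)
  have Xb: "norm X \<le> K + 1 + r" using X r by simp
  have "norm ((\<epsilon> * h) *\<^sub>R rot (B (\<epsilon> *\<^sub>R X)) h V) \<le> (\<epsilon> * h) * \<Lambda>"
    using norm_rot_le[of h "B (\<epsilon> *\<^sub>R X)" V] V \<Lambda> r h eps by (simp add: abs_mult)
  moreover have "norm ((h\<^sup>2 * \<epsilon>\<^sup>2 / 2) *\<^sub>R avg_field E X X') \<le> (\<epsilon> * h) * \<Lambda>"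
  proof -
    have "h\<^sup>2 * \<epsilon>\<^sup>2 / 2 \<le> \<epsilon> * h"
    proof -
      have "\<epsilon> * h \<le> 1" using eps h by (simp add: mult_le_one)
      then have "(\<epsilon> * h) * (\<epsilon> * h) \<le> (\<epsilon> * h) * 1" using eps h by (intro mult_left_mono) auto
      moreover have "h\<^sup>2 * \<epsilon>\<^sup>2 = (\<epsilon> * h) * (\<epsilon> * h)" by (simp add: power2_eq_square)
      moreover have "0 \<le> \<epsilon> * h" using eps h by simp
      ultimately show ?thesis by linarith
    qed
    then have "(h\<^sup>2 * \<epsilon>\<^sup>2 / 2) * norm (avg_field E X X') \<le> (\<epsilon> * h) * \<Lambda>"
      using norm_avg_field_le[OF Xb X'] eps h by (intro mult_mono) auto
    then show ?thesis by simp
  qed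
  moreover have "X' = X + ((\<epsilon> * h) *\<^sub>R rot (B (\<epsilon> *\<^sub>R X)) h V + (h\<^sup>2 * \<epsilon>\<^sup>2 / 2) *\<^sub>R avg_field E X X')"
    using st unfolding step_def fst_conv snd_conv add.assoc by blast
  then have "X' - X = (\<epsilon> * h) *\<^sub>R rot (B (\<epsilon> *\<^sub>R X)) h V + (h\<^sup>2 * \<epsilon>\<^sup>2 / 2) *\<^sub>R avg_field E X X'"
    by (metis add_diff_cancel_left')
  ultimately have "norm (X' - X) \<le> (\<epsilon> * h) * \<Lambda> + (\<epsilon> * h) * \<Lambda>"
    by (simp only: norm_triangle_le add_mono)
  then show "norm (X' - X) \<le> 2 * \<Lambda> * (\<epsilon> * h)" by (simp add: algebra_simps)
qed

lemma v_err_step: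
  assumes h: "0 < h" "h \<le> 1" "h * norm (B 0) \<le> 2" and t: "0 \<le> t" "t + h \<le> S"
    and X: "norm X \<le> K + 1" and V: "norm V \<le> K + 1" and st: "step h (X, V) (X', V')"
  shows "norm (v_err h (t + h) V') \<le> norm (v_err h t V) + 2 * \<Lambda>\<^sup>2 * (\<epsilon> * h) * norm (X - x t) + 9 * \<Lambda>^3 * (\<epsilon> * h)\<^sup>2"
proof -
  have tS: "t \<le> S" using t h by simp
  have c1: "cos (h * norm (B 0)) \<noteq> 1" using gyr_coeff_bound(2)[of h "norm (B 0)"] h B0 by simp
  define A where "A = avg_field E X X'"
  define D where "D = gyr (-1) (B 0) h (E (x t))"
  define D' where "D' = gyr (-1) (B 0) h (E (x (t + h)))"
  define R where "R = rot (B (\<epsilon> *\<^sub>R x t)) h"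
  define RX where "RX = rot (B (\<epsilon> *\<^sub>R X)) h"
  define \<rho> where "\<rho> = v (t + h) - R (v t) - \<epsilon> *\<^sub>R irot (B 0) h (E (x t))"
  have Xb: "norm X \<le> K + 1 + r" using X r by simp
  have V': "V' = RX V + (h * \<epsilon>) *\<^sub>R A" using st by (simp add: step_def RX_def A_def)
  have D1: "rot (B 0) h D - D = irot (B 0) h (E (x t)) - h *\<^sub>R E (x t)"
    unfolding D_def gyr_rot(2)[OF B0 c1] using gyr_rot(1)[OF B0 c1, of "-1"] by simp
  have "irot (B 0) h (E (x t)) = rot (B 0) h D - D + h *\<^sub>R E (x t)" using D1 by simp
  then have v': "v (t + h) = \<rho> + R (v t) + \<epsilon> *\<^sub>R (rot (B 0) h D - D + h *\<^sub>R E (x t))"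
    by (simp add: \<rho>_def)
  have "v_err h (t + h) V' = R (v_err h t V) + ((RX V - R V) + (h * \<epsilon>) *\<^sub>R (A - E (x t)) - \<rho> + \<epsilon> *\<^sub>R (R D - rot (B 0) h D) + \<epsilon> *\<^sub>R (D - D'))"
    unfolding v_err_def D_def[symmetric] D'_def[symmetric] V' v'
    by (simp add: R_def rot_add rot_diff rot_scaleR algebra_simps)
  then have "norm (v_err h (t + h) V') \<le> norm (R (v_err h t V)) +
     (norm (RX V - R V) + norm ((h * \<epsilon>) *\<^sub>R (A - E (x t))) + norm \<rho> + norm (\<epsilon> *\<^sub>R (R D - rot (B 0) h D)) + norm (\<epsilon> *\<^sub>R (D - D')))"
    by (auto intro!: norm_triangle_le norm_triangle_le_diff add_mono order_refl)
  moreover have "norm (R (v_err h t V)) \<le> norm (v_err h t V)" unfolding R_def using h by (intro norm_rot_le) simp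
  moreover have "norm (RX V - R V) \<le> \<Lambda>\<^sup>2 * (\<epsilon> * h) * norm (X - x t)"
  proof -
    have "norm (RX V - R V) \<le> h * (norm V * norm (B (\<epsilon> *\<^sub>R X) - B (\<epsilon> *\<^sub>R x t)))"
      unfolding RX_def R_def using h by (intro norm_rot_diff_le) simp
    also have "\<dots> \<le> h * (\<Lambda> * (\<Lambda> * (\<epsilon> * norm (X - x t))))"
      using B_lip_scaled[OF Xb x_ball[OF t(1) tS]] V \<Lambda> r h by (intro mult_left_mono mult_mono) auto
    finally show ?thesis by (simp add: power2_eq_square algebra_simps)
  qed
  moreover have "norm ((h * \<epsilon>) *\<^sub>R (A - E (x t))) \<le> \<Lambda>\<^sup>2 * (\<epsilon> * h) * norm (X - x t) + 2 * \<Lambda>^3 * (\<epsilon> * h)\<^sup>2"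
  proof -
    have "norm (avg_field E X X' - E (x t)) \<le> norm (avg_field E X X' - avg_field E X X) + norm (E X - E (x t))"
      using norm_triangle_ineq[of "avg_field E X X' - avg_field E X X" "E X - E (x t)"] by (simp add: avg_field_same)
    also have "\<dots> \<le> \<Lambda> * norm (X' - X) + \<Lambda> * norm (X - x t)"
      using norm_avg_field_diff_le[OF Xb step_distance(1)[OF h(1,2) X V st] Xb] E_lip[OF Xb x_ball[OF t(1) tS]] by simp
    also have "\<dots> \<le> \<Lambda> * (2 * \<Lambda> * (\<epsilon> * h)) + \<Lambda> * norm (X - x t)"
      using step_distance(2)[OF h(1,2) X V st] \<Lambda> by simp
    also have "\<dots> \<le> \<Lambda> * (\<Lambda> * (2 * \<Lambda> * (\<epsilon> * h))) + \<Lambda> * (\<Lambda> * norm (X - x t))"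
      using \<Lambda> eps h mult_right_mono[of 1 \<Lambda> "2 * \<Lambda> * (\<epsilon> * h)"] mult_right_mono[of 1 \<Lambda> "norm (X - x t)"]
      by (intro add_mono mult_left_mono) auto
    finally have "(h * \<epsilon>) * norm (A - E (x t)) \<le> (h * \<epsilon>) * (\<Lambda> * (\<Lambda> * (2 * \<Lambda> * (\<epsilon> * h))) + \<Lambda> * (\<Lambda> * norm (X - x t)))"
      unfolding A_def using eps h by simp
    moreover have "norm ((h * \<epsilon>) *\<^sub>R (A - E (x t))) = (h * \<epsilon>) * norm (A - E (x t))" using eps h by simp
    ultimately show ?thesis by (simp add: power2_eq_square power3_eq_cube algebra_simps)
  qed
  moreover have "norm \<rho> \<le> 3 * \<Lambda>^3 * (\<epsilon> * h)\<^sup>2"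
    using v_variation_of_constants[of t h] t h by (simp add: \<rho>_def R_def power_mult_distrib mult.assoc)
  moreover have "norm (\<epsilon> *\<^sub>R (R D - rot (B 0) h D)) \<le> 2 * \<Lambda>^3 * (\<epsilon> * h)\<^sup>2"
  proof -
    have D: "norm D \<le> 2 * h * \<Lambda>"
      unfolding D_def using h t(1) tS E_x_le by (intro norm_gyr_le_bound) auto
    have "norm (R D - rot (B 0) h D) \<le> h * (norm D * norm (B (\<epsilon> *\<^sub>R x t) - B 0))"
      unfolding R_def using h by (intro norm_rot_diff_le) simp
    also have "\<dots> \<le> h * ((2 * h * \<Lambda>) * (\<epsilon> * \<Lambda>\<^sup>2))"
      using D B_near_B0[OF t(1) tS] h \<Lambda> by (intro mult_left_mono mult_mono) auto
    finally have "\<epsilon> * norm (R D - rot (B 0) h D) \<le> \<epsilon> * (h * ((2 * h * \<Lambda>) * (\<epsilon> * \<Lambda>\<^sup>2)))" using eps by simp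
    moreover have "norm (\<epsilon> *\<^sub>R (R D - rot (B 0) h D)) = \<epsilon> * norm (R D - rot (B 0) h D)" using eps by simp
    ultimately show ?thesis by (simp add: power2_eq_square power3_eq_cube algebra_simps)
  qed
  moreover have "norm (\<epsilon> *\<^sub>R (D - D')) \<le> 2 * \<Lambda>^3 * (\<epsilon> * h)\<^sup>2"
  proof -
    have "norm (D - D') \<le> 2 * h * norm (E (x t) - E (x (t + h)))"
      unfolding D_def D'_def gyr_diff[symmetric] using h B0 by (intro norm_gyr_le) auto
    also have "norm (E (x t) - E (x (t + h))) \<le> \<Lambda> * norm (x t - x (t + h))"
      using t h by (intro E_lip x_ball) auto
    also have "norm (x t - x (t + h)) \<le> \<epsilon> * \<Lambda> * h"
      using x_increment[of t h] t h by (simp add: norm_minus_commute)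
    also have "\<epsilon> * \<Lambda> * h \<le> \<Lambda> * (\<epsilon> * \<Lambda> * h)" using \<Lambda> eps h mult_right_mono[of 1 \<Lambda> "\<epsilon> * \<Lambda> * h"] by simp
    finally have "norm (D - D') \<le> 2 * h * (\<Lambda> * (\<Lambda> * (\<epsilon> * \<Lambda> * h)))" using h \<Lambda> by simp
    then have "\<epsilon> * norm (D - D') \<le> \<epsilon> * (2 * h * (\<Lambda> * (\<Lambda> * (\<epsilon> * \<Lambda> * h))))" using eps by simp
    moreover have "norm (\<epsilon> *\<^sub>R (D - D')) = \<epsilon> * norm (D - D')" using eps by simp
    ultimately show ?thesis by (simp add: power2_eq_square power3_eq_cube algebra_simps)
  qed
  ultimately show ?thesis by linarith
qed

lemma x_err_step:
  assumes h: "0 < h" "h \<le> 1" "h * norm (B 0) \<le> 2" and t: "0 \<le> t" "t + h \<le> S"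
    and X: "norm X \<le> K + 1" and V: "norm V \<le> K + 1" and st: "step h (X, V) (X', V')"
  shows "norm (x_err h (t + h) X') \<le> norm (x_err h t X) + (\<epsilon> * h) * norm (V' - v (t + h)) + 9 * \<Lambda>^3 * (\<epsilon> * h)\<^sup>2"
proof -
  have tS: "t \<le> S" using t h by simp
  have c1: "cos (h * norm (B 0)) \<noteq> 1" using gyr_coeff_bound(2)[of h "norm (B 0)"] h B0 by simp
  define A where "A = avg_field E X X'"
  define \<rho> where "\<rho> = x (t + h) - x t - \<epsilon> *\<^sub>R irot (B 0) h (v t)"
  define \<rho>' where "\<rho>' = v (t + h) - rot (B 0) h (v t)"
  define G where "G = gyr 1 (B 0) h"
  have Xb: "norm X \<le> K + 1 + r" using X r by simp
  have "X' = X + (\<epsilon> * h) *\<^sub>R (V' - (h * \<epsilon>) *\<^sub>R A) + (h\<^sup>2 * \<epsilon>\<^sup>2 / 2) *\<^sub>R A" using st by (simp add: step_def A_def)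
  then have X': "X' = X + (\<epsilon> * h) *\<^sub>R V' - ((\<epsilon> * h)\<^sup>2 / 2) *\<^sub>R A"
  proof -
    have "(\<epsilon> * h) *\<^sub>R ((h * \<epsilon>) *\<^sub>R A) = ((\<epsilon> * h)\<^sup>2 / 2) *\<^sub>R A + ((\<epsilon> * h)\<^sup>2 / 2) *\<^sub>R A"
      by (simp add: scaleR_add_left[symmetric] power2_eq_square mult.assoc mult.left_commute)
    moreover have "h\<^sup>2 * \<epsilon>\<^sup>2 / 2 = (\<epsilon> * h)\<^sup>2 / 2" by (simp add: power_mult_distrib)
    ultimately show ?thesis using \<open>X' = _\<close> by (simp only: scaleR_diff_right) simp
  qed
  have "irot (B 0) h (v t) = G (rot (B 0) h (v t) - v t) + h *\<^sub>R rot (B 0) h (v t)"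
    unfolding G_def using gyr_rot(1)[OF B0 c1, of 1] by simp
  also have "rot (B 0) h (v t) = v (t + h) - \<rho>'" by (simp add: \<rho>'_def)
  also have "G (v (t + h) - \<rho>' - v t) = G (v (t + h)) - G \<rho>' - G (v t)" by (simp add: G_def gyr_diff)
  finally have x': "x (t + h) = x t + \<rho> + \<epsilon> *\<^sub>R (G (v (t + h)) - G \<rho>' - G (v t) + h *\<^sub>R (v (t + h) - \<rho>'))"
    by (simp add: \<rho>_def)
  have "x_err h (t + h) X' = x_err h t X + ((\<epsilon> * h) *\<^sub>R (V' - v (t + h)) - ((\<epsilon> * h)\<^sup>2 / 2) *\<^sub>R A - \<rho> + \<epsilon> *\<^sub>R G \<rho>' + (\<epsilon> * h) *\<^sub>R \<rho>')"
    unfolding x_err_def G_def[symmetric] X' x' by (simp add: algebra_simps)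
  then have "norm (x_err h (t + h) X') \<le> norm (x_err h t X) + (norm ((\<epsilon> * h) *\<^sub>R (V' - v (t + h)))
      + norm (((\<epsilon> * h)\<^sup>2 / 2) *\<^sub>R A) + norm \<rho> + norm (\<epsilon> *\<^sub>R G \<rho>') + norm ((\<epsilon> * h) *\<^sub>R \<rho>'))"
    by (auto intro!: norm_triangle_le norm_triangle_le_diff add_mono order_refl)
  moreover have "norm ((\<epsilon> * h) *\<^sub>R (V' - v (t + h))) = (\<epsilon> * h) * norm (V' - v (t + h))"
    using eps h by (simp add: abs_mult)
  moreover have "norm (((\<epsilon> * h)\<^sup>2 / 2) *\<^sub>R A) \<le> \<Lambda>^3 * (\<epsilon> * h)\<^sup>2"
  proof -
    have "norm A \<le> \<Lambda>" unfolding A_def using norm_avg_field_le[OF Xb step_distance(1)[OF h(1,2) X V st]] .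
    moreover have "\<Lambda> \<le> \<Lambda>^3" using \<Lambda> power_increasing[of 1 3 \<Lambda>] by simp
    ultimately have "(\<epsilon> * h)\<^sup>2 / 2 * norm A \<le> (\<epsilon> * h)\<^sup>2 * \<Lambda>^3" by (intro mult_mono) auto
    then show ?thesis by (simp add: mult.commute)
  qed
  moreover have "norm \<rho> \<le> 2 * \<Lambda>^3 * (\<epsilon> * h)\<^sup>2"
    using x_free_rotation[of t h] t h by (simp add: \<rho>_def power_mult_distrib mult.assoc)
  moreover have \<rho>': "norm \<rho>' \<le> 2 * \<Lambda>^3 * \<epsilon> * h"
    using v_free_rotation[of t h] t h by (simp add: \<rho>'_def)
  moreover have "norm (\<epsilon> *\<^sub>R G \<rho>') \<le> 4 * \<Lambda>^3 * (\<epsilon> * h)\<^sup>2"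
  proof -
    have "norm (G \<rho>') \<le> 2 * h * norm \<rho>'" unfolding G_def using h B0 by (intro norm_gyr_le) auto
    also have "\<dots> \<le> 2 * h * (2 * \<Lambda>^3 * \<epsilon> * h)" using \<rho>' h by (intro mult_left_mono) auto
    finally have "\<epsilon> * norm (G \<rho>') \<le> \<epsilon> * (2 * h * (2 * \<Lambda>^3 * \<epsilon> * h))" using eps by simp
    then show ?thesis using eps by (simp add: power2_eq_square algebra_simps)
  qed
  moreover have "norm ((\<epsilon> * h) *\<^sub>R \<rho>') \<le> 2 * \<Lambda>^3 * (\<epsilon> * h)\<^sup>2"
  proof -
    have "(\<epsilon> * h) * norm \<rho>' \<le> (\<epsilon> * h) * (2 * \<Lambda>^3 * \<epsilon> * h)" using \<rho>' eps h by (intro mult_left_mono) auto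
    then show ?thesis using eps h by (simp add: abs_mult power2_eq_square algebra_simps)
  qed
  ultimately show ?thesis by linarith
qed

definition err :: "real \<Rightarrow> real \<Rightarrow> (real^3) \<times> (real^3) \<Rightarrow> real" where
  "err h t p = norm (x_err h t (fst p)) + norm (v_err h t (snd p))"

lemma err_step:
  assumes h: "0 < h" "h \<le> 1" "h * norm (B 0) \<le> 2" and t: "0 \<le> t" "t + h \<le> S"
    and X: "norm (fst p) \<le> K + 1" and V: "norm (snd p) \<le> K + 1" and st: "step h p q"
  shows "err h (t + h) q \<le> (1 + 5 * \<Lambda>\<^sup>2 * (\<epsilon> * h)) * err h t p + 37 * \<Lambda>^3 * (\<epsilon> * h)\<^sup>2"
proof -
  define \<kappa> where "\<kappa> = \<epsilon> * h"
  define a c a' c' where "a = norm (x_err h t (fst p))" and "c = norm (v_err h t (snd p))"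
    and "a' = norm (x_err h (t + h) (fst q))" and "c' = norm (v_err h (t + h) (snd q))"
  have \<kappa>: "0 < \<kappa>" "\<kappa> \<le> 1" using eps h by (auto simp: \<kappa>_def mult_le_one)
  have tS: "t \<le> S" using t h by simp
  have nn: "0 \<le> a" "0 \<le> c" by (auto simp: a_def c_def)
  have \<Lambda>2: "1 \<le> \<Lambda>\<^sup>2" using \<Lambda> by (simp add: one_le_power)
  have \<Lambda>3: "\<Lambda> \<le> \<Lambda>^3" using \<Lambda> power_increasing[of 1 3 \<Lambda>] by simp
  have st': "step h (fst p, snd p) (fst q, snd q)" using st by simp
  have e: "norm (fst p - x t) \<le> a + 2 * \<Lambda> * \<kappa>"
    using x_err_close[OF h(1,3) t(1) tS, of "fst p"] norm_triangle_ineq2[of "fst p - x t" "x_err h t (fst p)"]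
    unfolding a_def \<kappa>_def by (simp add: norm_minus_commute)
  have f: "norm (snd q - v (t + h)) \<le> c' + 2 * \<Lambda> * \<kappa>"
    using v_err_close[OF h(1,3), of "t + h" "snd q"] norm_triangle_ineq2[of "snd q - v (t + h)" "v_err h (t + h) (snd q)"] t h
    unfolding c'_def \<kappa>_def by (simp add: norm_minus_commute)
  have "c' \<le> c + 2 * \<Lambda>\<^sup>2 * \<kappa> * norm (fst p - x t) + 9 * \<Lambda>^3 * \<kappa>\<^sup>2"
    unfolding c_def c'_def \<kappa>_def by (rule v_err_step[OF h t X V st'])
  also have "2 * \<Lambda>\<^sup>2 * \<kappa> * norm (fst p - x t) \<le> 2 * \<Lambda>\<^sup>2 * \<kappa> * (a + 2 * \<Lambda> * \<kappa>)"
    using e \<kappa> by (intro mult_left_mono) auto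
  also have "c + 2 * \<Lambda>\<^sup>2 * \<kappa> * (a + 2 * \<Lambda> * \<kappa>) + 9 * \<Lambda>^3 * \<kappa>\<^sup>2 = c + 2 * (\<Lambda>\<^sup>2 * \<kappa> * a) + 13 * (\<Lambda>^3 * \<kappa>\<^sup>2)"
    by (simp add: power2_eq_square power3_eq_cube algebra_simps)
  finally have c': "c' \<le> c + 2 * (\<Lambda>\<^sup>2 * \<kappa> * a) + 13 * (\<Lambda>^3 * \<kappa>\<^sup>2)" by simp
  have "a' \<le> a + \<kappa> * norm (snd q - v (t + h)) + 9 * \<Lambda>^3 * \<kappa>\<^sup>2"
    unfolding a_def a'_def \<kappa>_def by (rule x_err_step[OF h t X V st'])
  also have "\<kappa> * norm (snd q - v (t + h)) \<le> \<kappa> * (c + 2 * (\<Lambda>\<^sup>2 * \<kappa> * a) + 13 * (\<Lambda>^3 * \<kappa>\<^sup>2) + 2 * \<Lambda> * \<kappa>)"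
    using f c' \<kappa> by (intro mult_left_mono) auto
  also have "\<dots> \<le> \<kappa> * c + 2 * (\<Lambda>\<^sup>2 * \<kappa> * a) + 15 * (\<Lambda>^3 * \<kappa>\<^sup>2)"
  proof -
    have "\<kappa> * (\<Lambda>\<^sup>2 * \<kappa> * a) \<le> \<Lambda>\<^sup>2 * \<kappa> * a" using \<kappa> nn by (intro mult_left_le_one_le) auto
    moreover have "\<kappa> * (\<Lambda>^3 * \<kappa>\<^sup>2) \<le> \<Lambda>^3 * \<kappa>\<^sup>2" using \<kappa> \<Lambda> by (intro mult_left_le_one_le) auto
    moreover have "\<Lambda> * \<kappa>\<^sup>2 \<le> \<Lambda>^3 * \<kappa>\<^sup>2" using \<Lambda>3 by (intro mult_right_mono) auto
    ultimately show ?thesis by (simp add: algebra_simps power2_eq_square)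
  qed
  finally have a': "a' \<le> a + \<kappa> * c + 2 * (\<Lambda>\<^sup>2 * \<kappa> * a) + 24 * (\<Lambda>^3 * \<kappa>\<^sup>2)" by simp
  have "\<kappa> * c \<le> \<Lambda>\<^sup>2 * \<kappa> * c" using \<Lambda>2 \<kappa> nn by (simp add: mult_le_cancel_right1)
  moreover have "0 \<le> \<Lambda>\<^sup>2 * \<kappa> * a" "0 \<le> \<Lambda>\<^sup>2 * \<kappa> * c" using \<kappa> nn by auto
  ultimately have "a' + c' \<le> a + c + 5 * (\<Lambda>\<^sup>2 * \<kappa> * a) + 5 * (\<Lambda>\<^sup>2 * \<kappa> * c) + 37 * (\<Lambda>^3 * \<kappa>\<^sup>2)"
    using a' c' by linarith
  then show ?thesis unfolding err_def a_def[symmetric] c_def[symmetric] a'_def[symmetric] c'_def[symmetric] \<kappa>_def[symmetric]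
    by (simp add: algebra_simps)
qed

definition err_const :: real where
  "err_const = exp (5 * \<Lambda>\<^sup>2 * (\<epsilon> * S)) * (4 * \<Lambda> + 37 * \<Lambda>^3 * (\<epsilon> * S)) + 2 * \<Lambda>"

lemma error_bound:
  assumes h: "0 < h" "h \<le> 1" "h * norm (B 0) \<le> 2" "err_const * h \<le> 1"
    and p0: "p 0 = (x 0, v 0)" and n: "real n * h \<le> S"
    and st: "\<And>k. k < n \<Longrightarrow> step h (p k) (p (Suc k))"
  shows "norm (fst (p n) - x (real n * h)) \<le> err_const * (\<epsilon> * h) \<and> norm (snd (p n) - v (real n * h)) \<le> err_const * (\<epsilon> * h)
    \<and> norm (fst (p n)) \<le> K + 1 \<and> norm (snd (p n)) \<le> K + 1"
proof -
  define \<kappa> where "\<kappa> = \<epsilon> * h"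
  define L where "L = 5 * \<Lambda>\<^sup>2 * \<kappa>"
  define M where "M = 37 * \<Lambda>^3 * \<kappa>\<^sup>2"
  have \<kappa>: "0 < \<kappa>" using eps h by (auto simp: \<kappa>_def)
  have LM: "0 \<le> L" "0 \<le> M" using \<kappa> \<Lambda> by (auto simp: L_def M_def)
  have conv: "norm (fst (p m) - x (real m * h)) \<le> err_const * \<kappa> \<and> norm (snd (p m) - v (real m * h)) \<le> err_const * \<kappa>
    \<and> norm (fst (p m)) \<le> K + 1 \<and> norm (snd (p m)) \<le> K + 1"
    if W: "err h (real m * h) (p m) \<le> (1 + L) ^ m * (4 * \<Lambda> * \<kappa> + real m * M)" and mS: "real m * h \<le> S" for m
  proof -
    have m0: "0 \<le> real m * h" using h by simp
    have mk: "real m * \<kappa> \<le> \<epsilon> * S" using mS eps by (simp add: \<kappa>_def mult.left_commute)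
    have "(1 + L) ^ m \<le> exp L ^ m" using LM exp_ge_add_one_self[of L] by (intro power_mono) auto
    also have "\<dots> = exp (5 * \<Lambda>\<^sup>2 * (real m * \<kappa>))" by (simp add: exp_of_nat_mult[symmetric] L_def algebra_simps)
    also have "\<dots> \<le> exp (5 * \<Lambda>\<^sup>2 * (\<epsilon> * S))" using mk by (simp add: mult_left_mono)
    finally have p1: "(1 + L) ^ m \<le> exp (5 * \<Lambda>\<^sup>2 * (\<epsilon> * S))" .
    have "real m * M = (37 * \<Lambda>^3 * (real m * \<kappa>)) * \<kappa>" by (simp add: M_def power2_eq_square)
    also have "\<dots> \<le> (37 * \<Lambda>^3 * (\<epsilon> * S)) * \<kappa>" using mk \<kappa> \<Lambda> by (intro mult_right_mono mult_left_mono) auto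
    finally have p2: "4 * \<Lambda> * \<kappa> + real m * M \<le> (4 * \<Lambda> + 37 * \<Lambda>^3 * (\<epsilon> * S)) * \<kappa>" by (simp add: algebra_simps)
    have "(1 + L) ^ m * (4 * \<Lambda> * \<kappa> + real m * M) \<le> exp (5 * \<Lambda>\<^sup>2 * (\<epsilon> * S)) * ((4 * \<Lambda> + 37 * \<Lambda>^3 * (\<epsilon> * S)) * \<kappa>)"
      using p1 p2 LM \<Lambda> \<kappa> by (intro mult_mono) auto
    with W have "err h (real m * h) (p m) \<le> (err_const - 2 * \<Lambda>) * \<kappa>" by (simp add: err_const_def mult.assoc)
    then have We: "norm (x_err h (real m * h) (fst (p m))) + norm (v_err h (real m * h) (snd (p m))) + 2 * \<Lambda> * \<kappa> \<le> err_const * \<kappa>"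
      by (simp add: err_def algebra_simps)
    have 1: "norm (fst (p m) - x (real m * h)) \<le> err_const * \<kappa>"
      using We x_err_close[OF h(1,3) m0 mS, of "fst (p m)", folded \<kappa>_def]
        norm_triangle_sub[of "fst (p m) - x (real m * h)" "x_err h (real m * h) (fst (p m))"]
        norm_ge_zero[of "v_err h (real m * h) (snd (p m))"]
        norm_minus_commute[of "x_err h (real m * h) (fst (p m))" "fst (p m) - x (real m * h)"] by linarith
    have 2: "norm (snd (p m) - v (real m * h)) \<le> err_const * \<kappa>"
      using We v_err_close[OF h(1,3) m0 mS, of "snd (p m)", folded \<kappa>_def]
        norm_triangle_sub[of "snd (p m) - v (real m * h)" "v_err h (real m * h) (snd (p m))"]
        norm_ge_zero[of "x_err h (real m * h) (fst (p m))"]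
        norm_minus_commute[of "v_err h (real m * h) (snd (p m))" "snd (p m) - v (real m * h)"] by linarith
    have "err_const * \<kappa> \<le> 1"
    proof -
      have "err_const * \<kappa> = \<epsilon> * (err_const * h)" by (simp add: \<kappa>_def)
      also have "\<dots> \<le> \<epsilon> * 1" using h eps by (intro mult_left_mono) auto
      finally show ?thesis using eps by simp
    qed
    then show ?thesis using 1 2 x_bound[OF m0 mS] v_bound[OF m0 mS]
        norm_triangle_sub[of "fst (p m)" "x (real m * h)"] norm_triangle_sub[of "snd (p m)" "v (real m * h)"] by linarith
  qed
  have "err h (real m * h) (p m) \<le> (1 + L) ^ m * (4 * \<Lambda> * \<kappa> + real m * M)" if "m \<le> n" for m
    using that
  proof (induction m)
    case 0
    have "0 \<le> real n * h" using h by simp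
    then have "0 \<le> S" using n by linarith
    then show ?case using x_err_close[OF h(1,3), of 0 "x 0"] v_err_close[OF h(1,3), of 0 "v 0"]
      by (simp add: err_def p0 \<kappa>_def)
  next
    case (Suc m)
    then have W: "err h (real m * h) (p m) \<le> (1 + L) ^ m * (4 * \<Lambda> * \<kappa> + real m * M)" by simp
    have "real (Suc m) * h \<le> real n * h" using Suc.prems h by (intro mult_right_mono) auto
    then have mS: "real m * h + h \<le> S" using n by (simp add: algebra_simps)
    then have mS': "real m * h \<le> S" using h by simp
    have "err h (real m * h + h) (p (Suc m)) \<le> (1 + L) * err h (real m * h) (p m) + M"
      unfolding L_def M_def \<kappa>_def using conv[OF W mS'] mS h st Suc.prems by (intro err_step) auto
    also have "\<dots> \<le> (1 + L) * ((1 + L) ^ m * (4 * \<Lambda> * \<kappa> + real m * M)) + (1 + L) ^ Suc m * M"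
      using W LM by (intro add_mono mult_left_mono) (auto simp: mult_le_cancel_right1 simp del: power_Suc intro!: one_le_power)
    finally show ?case by (simp add: algebra_simps)
  qed
  from conv[OF this[OF order_refl] n] show ?thesis by (simp add: \<kappa>_def)
qed

lemma step_exists:
  assumes h: "0 < h" "h \<le> 1" "2 * \<Lambda> * h \<le> r"
    and X: "norm X \<le> K + 1" and V: "norm V \<le> K + 1"
  obtains q where "step h (X, V) q"
proof -
  define F where "F z = X + (\<epsilon> * h) *\<^sub>R rot (B (\<epsilon> *\<^sub>R X)) h V + (h\<^sup>2 * \<epsilon>\<^sup>2 / 2) *\<^sub>R avg_field E X z" for z
  have Xb: "norm X \<le> K + 1 + r" using X r by simp
  have zb: "norm z \<le> K + 1 + r" if "z \<in> cball X r" for z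
    using that X norm_triangle_sub[of z X] by (simp add: dist_norm norm_minus_commute)
  have "\<Lambda>-lipschitz_on (cball X r) (avg_field E X)"
    using norm_avg_field_diff_le[OF Xb zb zb] \<Lambda> by (intro lipschitz_onI) (auto simp: dist_norm)
  then have cont: "continuous_on (cball X r) F"
    unfolding F_def[abs_def] by (intro continuous_intros lipschitz_on_continuous_on)
  have into: "F z \<in> cball X r" if z: "z \<in> cball X r" for z
  proof -
    have eh: "0 \<le> \<epsilon> * h" "\<epsilon> * h \<le> h" "\<epsilon> * h \<le> 1" using eps h by (auto simp: mult_le_one)
    have "norm ((\<epsilon> * h) *\<^sub>R rot (B (\<epsilon> *\<^sub>R X)) h V) \<le> h * \<Lambda>"
      using norm_rot_le[of h "B (\<epsilon> *\<^sub>R X)" V] V \<Lambda> r eh h by (simp add: mult_mono)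
    moreover have "norm ((h\<^sup>2 * \<epsilon>\<^sup>2 / 2) *\<^sub>R avg_field E X z) \<le> h * \<Lambda>"
    proof -
      have "(\<epsilon> * h) * (\<epsilon> * h) \<le> 1 * h" using eh by (intro mult_mono) auto
      moreover have "h\<^sup>2 * \<epsilon>\<^sup>2 = (\<epsilon> * h) * (\<epsilon> * h)" by (simp add: power2_eq_square)
      ultimately have "h\<^sup>2 * \<epsilon>\<^sup>2 / 2 \<le> h" using h by linarith
      then have "(h\<^sup>2 * \<epsilon>\<^sup>2 / 2) * norm (avg_field E X z) \<le> h * \<Lambda>"
        using norm_avg_field_le[OF Xb zb[OF z]] h by (intro mult_mono) auto
      then show ?thesis by simp
    qed
    ultimately have "norm (F z - X) \<le> h * \<Lambda> + h * \<Lambda>"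
      unfolding F_def add.assoc add_diff_cancel_left' by (intro norm_triangle_le add_mono)
    also have "\<dots> \<le> r" using h by (simp add: algebra_simps)
    finally show ?thesis by (simp add: dist_norm norm_minus_commute)
  qed
  obtain z where z: "z \<in> cball X r" "F z = z"
    using brouwer[OF compact_cball convex_cball _ cont] into r by auto
  have "step h (X, V) (z, rot (B (\<epsilon> *\<^sub>R X)) h V + (h * \<epsilon>) *\<^sub>R avg_field E X z)"
    using z unfolding step_def F_def by simp
  then show ?thesis by (rule that)
qed

lemma steps_exist:
  assumes h: "0 < h" "h \<le> 1" "h * norm (B 0) \<le> 2" "err_const * h \<le> 1" "2 * \<Lambda> * h \<le> r"
  obtains p where "p 0 = (x 0, v 0)" "\<And>n. real (Suc n) * h \<le> S \<Longrightarrow> step h (p n) (p (Suc n))"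
proof -
  define p where "p = rec_nat (x 0, v 0) (\<lambda>_ q. SOME q'. step h q q')"
  have p0: "p 0 = (x 0, v 0)" and pS: "p (Suc n) = (SOME q'. step h (p n) q')" for n
    by (simp_all add: p_def)
  have "step h (p n) (p (Suc n))" if "real (Suc n) * h \<le> S" for n
    using that
  proof (induction n rule: less_induct)
    case (less n)
    have le: "real (Suc k) * h \<le> real (Suc n) * h" if "k \<le> n" for k
      using that h by (intro mult_right_mono) auto
    have "step h (p k) (p (Suc k))" if "k < n" for k
      using less.IH[OF that] le[of k] that less.prems by linarith
    moreover have "real n * h \<le> S" using less.prems h by (simp add: algebra_simps)
    ultimately have "norm (fst (p n)) \<le> K + 1 \<and> norm (snd (p n)) \<le> K + 1"
      using error_bound[of h p n] h p0 by blast
    then obtain q where "step h (fst (p n), snd (p n)) q" using step_exists[of h] h by blast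
    then show ?case unfolding pS by (intro someI[of "step h (p n)"]) simp
  qed
  with p0 show ?thesis by (rule that)
qed

end

section \<open>Stability of the parallel velocity\<close>

lemma C1_continuous:
  assumes "C1 f" shows "continuous_on UNIV f"
proof -
  obtain f' where d: "\<And>y. (f has_derivative blinfun_apply (f' y)) (at y)"
    using assms by (auto simp: C1_def)
  show ?thesis by (rule has_derivative_continuous_on[OF d])
qed

lemma C1_lipschitz_ball:
  fixes f :: "'a::{real_normed_vector,heine_borel} \<Rightarrow> 'b::real_normed_vector"
  assumes "C1 f"
  shows "\<exists>L\<ge>0. \<forall>y z. norm y \<le> \<rho> \<longrightarrow> norm z \<le> \<rho> \<longrightarrow> norm (f y - f z) \<le> L * norm (y - z)"
proof -
  obtain f' where d: "\<And>y. (f has_derivative blinfun_apply (f' y)) (at y)" and c: "continuous_on UNIV f'"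
    using assms by (auto simp: C1_def)
  have "compact (f' ` cball 0 \<rho>)"
    by (intro compact_continuous_image continuous_on_subset[OF c]) auto
  then obtain L where L: "0 < L" "\<And>y. y \<in> cball 0 \<rho> \<Longrightarrow> norm (f' y) \<le> L"
    using compact_imp_bounded bounded_pos by (metis imageI)
  have "norm (f y - f z) \<le> L * norm (y - z)" if "norm y \<le> \<rho>" "norm z \<le> \<rho>" for y z
  proof (rule differentiable_bound[OF convex_cball])
    show "\<And>y. y \<in> cball 0 \<rho> \<Longrightarrow> (f has_derivative blinfun_apply (f' y)) (at y within cball 0 \<rho>)"
      using d has_derivative_at_withinI by blast
  qed (use L that in \<open>auto simp: norm_blinfun.rep_eq[symmetric]\<close>)
  with L(1) show ?thesis by (intro exI[of _ L]) auto
qed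

lemma norm_sgn_diff_le:
  fixes a b :: "'a::real_normed_vector"
  assumes "b \<noteq> 0"
  shows "norm (a /\<^sub>R norm a - b /\<^sub>R norm b) \<le> 2 * norm (a - b) / norm b"
proof (cases "a = 0")
  case True then show ?thesis using assms by simp
next
  case False
  have "a /\<^sub>R norm a - b /\<^sub>R norm b = (inverse (norm a) - inverse (norm b)) *\<^sub>R a + inverse (norm b) *\<^sub>R (a - b)"
    by (simp add: algebra_simps)
  then have "norm (a /\<^sub>R norm a - b /\<^sub>R norm b)
      \<le> norm ((inverse (norm a) - inverse (norm b)) *\<^sub>R a) + norm (inverse (norm b) *\<^sub>R (a - b))"
    by (simp only: norm_triangle_ineq)
  also have "\<dots> = \<bar>inverse (norm a) - inverse (norm b)\<bar> * norm a + norm (a - b) / norm b"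
    by (simp add: divide_inverse mult.commute)
  also have "\<bar>inverse (norm a) - inverse (norm b)\<bar> * norm a = \<bar>norm b - norm a\<bar> / norm b"
  proof -
    have "inverse (norm a) - inverse (norm b) = (norm b - norm a) / (norm a * norm b)"
      using assms False by (simp add: field_simps)
    then show ?thesis using assms False by (simp add: abs_divide)
  qed
  also have "\<dots> \<le> norm (a - b) / norm b"
    using norm_triangle_ineq3[of b a] by (intro divide_right_mono) (auto simp: norm_minus_commute)
  finally show ?thesis by simp
qed

lemma norm_v_par_diff_le:
  assumes c: "0 < c" "c \<le> norm (B (\<epsilon> *\<^sub>R z))"
  shows "norm (v_par B \<epsilon> y w - v_par B \<epsilon> z w') \<le> 4 * norm w / c * norm (B (\<epsilon> *\<^sub>R y) - B (\<epsilon> *\<^sub>R z)) + norm (w - w')"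
proof -
  define a b where "a = B (\<epsilon> *\<^sub>R y) /\<^sub>R norm (B (\<epsilon> *\<^sub>R y))" and "b = B (\<epsilon> *\<^sub>R z) /\<^sub>R norm (B (\<epsilon> *\<^sub>R z))"
  have ab: "norm a \<le> 1" "norm b \<le> 1" by (simp_all add: a_def b_def divide_inverse[symmetric] mult.commute[of "inverse _"])
  have bn: "B (\<epsilon> *\<^sub>R z) \<noteq> 0" using c by auto
  have "norm (a - b) \<le> 2 * norm (B (\<epsilon> *\<^sub>R y) - B (\<epsilon> *\<^sub>R z)) / norm (B (\<epsilon> *\<^sub>R z))"
    unfolding a_def b_def by (rule norm_sgn_diff_le[OF bn])
  also have "\<dots> \<le> 2 * norm (B (\<epsilon> *\<^sub>R y) - B (\<epsilon> *\<^sub>R z)) / c"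
    using c by (intro divide_left_mono mult_pos_pos) auto
  finally have d: "norm (a - b) \<le> 2 * norm (B (\<epsilon> *\<^sub>R y) - B (\<epsilon> *\<^sub>R z)) / c" .
  have ip: "norm ((p \<bullet> q) *\<^sub>R s) \<le> norm p * norm q * norm s" for p q s :: "real^3"
    using Cauchy_Schwarz_ineq2[of p q] by (simp add: mult_right_mono)
  have "v_par B \<epsilon> y w - v_par B \<epsilon> z w' = (w \<bullet> a) *\<^sub>R (a - b) + (w \<bullet> (a - b)) *\<^sub>R b + ((w - w') \<bullet> b) *\<^sub>R b"
    unfolding v_par_def Let_def a_def[symmetric] b_def[symmetric]
    by (simp add: algebra_simps inner_commute[of _ w] inner_commute[of _ w'])
  also have "norm \<dots> \<le> norm w * norm a * norm (a - b) + norm w * norm (a - b) * norm b + norm (w - w') * norm b * norm b"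
    by (intro norm_triangle_le add_mono ip)
  also have "\<dots> \<le> norm w * 1 * norm (a - b) + norm w * norm (a - b) * 1 + norm (w - w') * 1 * 1"
    using ab by (intro add_mono mult_mono) auto
  also have "\<dots> = 2 * norm w * norm (a - b) + norm (w - w')" by simp
  also have "2 * norm w * norm (a - b) \<le> 2 * norm w * (2 * norm (B (\<epsilon> *\<^sub>R y) - B (\<epsilon> *\<^sub>R z)) / c)"
    using d by (intro mult_left_mono) auto
  finally show ?thesis by simp
qed

lemma second_order_gronwall:
  fixes p w b g :: "real \<Rightarrow> real^3"
  assumes \<tau>: "0 \<le> \<tau>" and cont: "continuous_on {0..\<tau>} p" "continuous_on {0..\<tau>} w"
    and p: "\<And>s. 0 < s \<Longrightarrow> s < \<tau> \<Longrightarrow> (p has_vector_derivative w s) (at s)"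
    and w: "\<And>s. 0 < s \<Longrightarrow> s < \<tau> \<Longrightarrow> (w has_vector_derivative w s \<times> b s + g s) (at s)"
    and g: "\<And>s. 0 < s \<Longrightarrow> s < \<tau> \<Longrightarrow> norm (g s) \<le> c * (\<delta> + norm (p s))"
    and c: "0 \<le> c" and \<delta>: "0 \<le> \<delta>" and init: "p 0 = 0" "w 0 = 0"
  shows "norm (p \<tau>) \<le> \<delta> * exp ((1 + 2 * c) * \<tau>)"
proof (cases "\<tau> = 0")
  case True then show ?thesis using \<delta> init by simp
next
  case False
  define k where "k = 1 + 2 * c"
  define \<phi> where "\<phi> s = p s \<bullet> p s + w s \<bullet> w s + \<delta>\<^sup>2" for s
  have d: "(\<phi> has_real_derivative 2 * (p s \<bullet> w s) + 2 * (w s \<bullet> g s)) (at s)" if "0 < s" "s < \<tau>" for s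
  proof -
    have "(\<phi> has_derivative (\<lambda>t. (p s \<bullet> (t *\<^sub>R w s) + (t *\<^sub>R w s) \<bullet> p s)
       + (w s \<bullet> (t *\<^sub>R (w s \<times> b s + g s)) + (t *\<^sub>R (w s \<times> b s + g s)) \<bullet> w s) + 0)) (at s)"
      unfolding \<phi>_def[abs_def] using p[OF that] w[OF that] unfolding has_vector_derivative_def
      by (intro has_derivative_add has_derivative_inner has_derivative_const)
    moreover have "(p s \<bullet> (t *\<^sub>R w s) + (t *\<^sub>R w s) \<bullet> p s)
       + (w s \<bullet> (t *\<^sub>R (w s \<times> b s + g s)) + (t *\<^sub>R (w s \<times> b s + g s)) \<bullet> w s) + 0
       = (2 * (p s \<bullet> w s) + 2 * (w s \<bullet> g s)) * t" for t
      by (simp add: inner_add_right inner_add_left dot_cross_self inner_commute[of "g s"] inner_commute[of "w s" "p s"] algebra_simps)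
    ultimately show ?thesis unfolding has_field_derivative_def by simp
  qed
  have dn: "2 * (p s \<bullet> w s) + 2 * (w s \<bullet> g s) \<le> k * \<phi> s" if "0 < s" "s < \<tau>" for s
  proof -
    define P W where "P = norm (p s)" and "W = norm (w s)"
    have "w s \<bullet> g s \<le> W * norm (g s)" unfolding W_def by (rule norm_cauchy_schwarz)
    also have "\<dots> \<le> W * (c * (\<delta> + P))" unfolding P_def using g[OF that] by (intro mult_left_mono) (auto simp: W_def)
    finally have 1: "w s \<bullet> g s \<le> c * (W * \<delta> + W * P)" by (simp add: algebra_simps)
    have sq: "2 * (W * \<delta>) \<le> W\<^sup>2 + \<delta>\<^sup>2" "2 * (W * P) \<le> W\<^sup>2 + P\<^sup>2"
      using sum_squares_bound[of W \<delta>] sum_squares_bound[of W P] by auto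
    then have "c * (2 * (W * \<delta>) + 2 * (W * P)) \<le> c * (2 * (P\<^sup>2 + W\<^sup>2 + \<delta>\<^sup>2))"
      using c by (intro mult_left_mono) (auto intro: order_trans[OF add_mono])
    moreover have "2 * (p s \<bullet> w s) \<le> P\<^sup>2 + W\<^sup>2 + \<delta>\<^sup>2"
    proof -
      have "p s \<bullet> w s \<le> W * P" using norm_cauchy_schwarz[of "p s" "w s"] by (simp add: P_def W_def mult.commute)
      with sq zero_le_power2[of \<delta>] show ?thesis by linarith
    qed
    moreover have "\<phi> s = P\<^sup>2 + W\<^sup>2 + \<delta>\<^sup>2" by (simp add: \<phi>_def P_def W_def power2_norm_eq_inner)
    ultimately show ?thesis using 1 by (simp add: k_def algebra_simps)
  qed
  have "- (exp (- k * 0) * \<phi> 0) \<le> - (exp (- k * \<tau>) * \<phi> \<tau>)"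
  proof (rule DERIV_nonneg_imp_increasing_open[OF \<tau>, of "\<lambda>s. - (exp (- k * s) * \<phi> s)"])
    show "continuous_on {0..\<tau>} (\<lambda>s. - (exp (- k * s) * \<phi> s))"
      unfolding \<phi>_def by (intro continuous_intros cont)
    fix s assume s: "0 < s" "s < \<tau>"
    have "((\<lambda>s. - (exp (- k * s) * \<phi> s)) has_real_derivative
        exp (- k * s) * (k * \<phi> s - (2 * (p s \<bullet> w s) + 2 * (w s \<bullet> g s)))) (at s)"
      by (auto intro!: derivative_eq_intros d[OF s] simp: algebra_simps)
    moreover have "0 \<le> exp (- k * s) * (k * \<phi> s - (2 * (p s \<bullet> w s) + 2 * (w s \<bullet> g s)))"
      using dn[OF s] by (intro mult_nonneg_nonneg) auto
    ultimately show "\<exists>y. ((\<lambda>s. - (exp (- k * s) * \<phi> s)) has_real_derivative y) (at s) \<and> 0 \<le> y" by blast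
  qed
  then have "exp (- k * \<tau>) * \<phi> \<tau> \<le> \<delta>\<^sup>2" by (simp add: \<phi>_def init)
  then have "\<phi> \<tau> \<le> \<delta>\<^sup>2 * exp (k * \<tau>)" by (simp add: exp_minus field_simps)
  also have "\<dots> \<le> \<delta>\<^sup>2 * (exp (k * \<tau>) * exp (k * \<tau>))"
  proof -
    have "1 \<le> exp (k * \<tau>)" using c \<tau> by (simp add: k_def)
    then show ?thesis by (intro mult_left_mono) (auto simp: mult_le_cancel_right1)
  qed
  also have "\<dots> = (\<delta> * exp (k * \<tau>))\<^sup>2"
    by (simp add: power_mult_distrib power2_eq_square)
  finally have "\<phi> \<tau> \<le> (\<delta> * exp (k * \<tau>))\<^sup>2" .
  moreover have "(norm (p \<tau>))\<^sup>2 \<le> \<phi> \<tau>"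
    by (simp add: \<phi>_def power2_norm_eq_inner)
  ultimately have "(norm (p \<tau>))\<^sup>2 \<le> (\<delta> * exp (k * \<tau>))\<^sup>2" by simp
  then show ?thesis unfolding k_def[symmetric] by (rule power2_le_imp_le) (use \<delta> in simp)
qed

lemma particle_solution_deriv:
  assumes "particle_solution B E T \<epsilon> x0 v0 x v" "0 < t" "t < T / \<epsilon>"
  shows "(x has_vector_derivative \<epsilon> *\<^sub>R v t) (at t)"
    and "(v has_vector_derivative v t \<times> B (\<epsilon> *\<^sub>R x t) + \<epsilon> *\<^sub>R E (x t)) (at t)"
  using assms unfolding particle_solution_def
  by (auto simp: at_within_Icc_at[symmetric])

lemma rescaled_solution:
  assumes sol: "particle_solution B E T \<epsilon> x0 v0 x v" and \<epsilon>: "0 < \<epsilon>"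
  shows "continuous_on {0..T} (\<lambda>s. x (s / \<epsilon>))" "continuous_on {0..T} (\<lambda>s. v (s / \<epsilon>))"
    and "0 < s \<Longrightarrow> s < T \<Longrightarrow> ((\<lambda>s. x (s / \<epsilon>)) has_vector_derivative v (s / \<epsilon>)) (at s)"
    and "0 < s \<Longrightarrow> s < T \<Longrightarrow> ((\<lambda>s. v (s / \<epsilon>)) has_vector_derivative
      v (s / \<epsilon>) \<times> (B (\<epsilon> *\<^sub>R x (s / \<epsilon>)) /\<^sub>R \<epsilon>) + E (x (s / \<epsilon>))) (at s)"
proof -
  have cx: "continuous_on {0..T/\<epsilon>} x" and cv: "continuous_on {0..T/\<epsilon>} v"
    using sol by (auto simp: particle_solution_def)
  show "continuous_on {0..T} (\<lambda>s. x (s / \<epsilon>))"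
    using \<epsilon> by (auto intro!: continuous_on_compose2[OF cx] continuous_intros simp: divide_right_mono)
  show "continuous_on {0..T} (\<lambda>s. v (s / \<epsilon>))"
    using \<epsilon> by (auto intro!: continuous_on_compose2[OF cv] continuous_intros simp: divide_right_mono)
  assume s: "0 < s" "s < T"
  have b: "0 < s / \<epsilon>" "s / \<epsilon> < T / \<epsilon>" using s \<epsilon> by (auto simp: divide_strict_right_mono)
  have d: "((\<lambda>s. s / \<epsilon>) has_vector_derivative inverse \<epsilon>) (at s)"
    using \<epsilon> by (auto intro!: derivative_eq_intros simp: has_real_derivative_iff_has_vector_derivative[symmetric] divide_inverse)
  show "((\<lambda>s. x (s / \<epsilon>)) has_vector_derivative v (s / \<epsilon>)) (at s)"
    using vector_diff_chain_at[OF d particle_solution_deriv(1)[OF sol b]] \<epsilon> by (simp add: o_def)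
  show "((\<lambda>s. v (s / \<epsilon>)) has_vector_derivative
      v (s / \<epsilon>) \<times> (B (\<epsilon> *\<^sub>R x (s / \<epsilon>)) /\<^sub>R \<epsilon>) + E (x (s / \<epsilon>))) (at s)"
    using vector_diff_chain_at[OF d particle_solution_deriv(2)[OF sol b]] \<epsilon>
    by (simp add: o_def scaleR_add_right cross_mult_right)
qed

lemma solution_lipschitz_in_eps:
  assumes sol: "particle_solution B E T \<epsilon> x0 v0 x v" "particle_solution B E T \<epsilon>' x0 v0 x' v'"
    and \<epsilon>: "e0 \<le> \<epsilon>" "\<epsilon> \<le> 1" "e0 \<le> \<epsilon>'" "\<epsilon>' \<le> 1" and e0: "0 < e0"
    and L: "0 \<le> K" "0 \<le> L"
    and bound: "\<And>t. t \<in> {0..T/\<epsilon>} \<Longrightarrow> norm (x t) \<le> K" "\<And>t. t \<in> {0..T/\<epsilon>'} \<Longrightarrow> norm (x' t) \<le> K"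
      "\<And>t. t \<in> {0..T/\<epsilon>'} \<Longrightarrow> norm (v' t) \<le> K"
    and B_bound: "\<And>y. norm y \<le> K \<Longrightarrow> norm (B y) \<le> L"
    and B_lip: "\<And>y z. norm y \<le> K \<Longrightarrow> norm z \<le> K \<Longrightarrow> norm (B y - B z) \<le> L * norm (y - z)"
    and E_lip: "\<And>y z. norm y \<le> K \<Longrightarrow> norm z \<le> K \<Longrightarrow> norm (E y - E z) \<le> L * norm (y - z)"
    and \<tau>: "0 \<le> \<tau>" "\<tau> \<le> T"
  defines "c \<equiv> K * (L / e0\<^sup>2 + L * K / e0 + L / e0) + L"
  shows "norm (x (\<tau> / \<epsilon>) - x' (\<tau> / \<epsilon>')) \<le> \<bar>\<epsilon> - \<epsilon>'\<bar> * exp ((1 + 2 * c) * \<tau>)"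
proof -
  have pos: "0 < \<epsilon>" "0 < \<epsilon>'" using \<epsilon> e0 by auto
  define X V X' V' where "X s = x (s / \<epsilon>)" and "V s = v (s / \<epsilon>)" and "X' s = x' (s / \<epsilon>')" and "V' s = v' (s / \<epsilon>')" for s
  define b b' where "b s = B (\<epsilon> *\<^sub>R X s) /\<^sub>R \<epsilon>" and "b' s = B (\<epsilon>' *\<^sub>R X' s) /\<^sub>R \<epsilon>'" for s
  note r = rescaled_solution[OF sol(1) pos(1), folded X_def V_def]
  note r' = rescaled_solution[OF sol(2) pos(2), folded X'_def V'_def]
  define g where "g s = V' s \<times> (b s - b' s) + (E (X s) - E (X' s))" for s
  define \<delta> where "\<delta> = \<bar>\<epsilon> - \<epsilon>'\<bar>"
  have c0: "0 \<le> c" using L e0 by (auto simp: c_def)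
  have "norm (X \<tau> - X' \<tau>) \<le> \<delta> * exp ((1 + 2 * c) * \<tau>)"
  proof (rule second_order_gronwall[OF \<tau>(1), where w = "\<lambda>s. V s - V' s" and b = b and g = g])
    show "continuous_on {0..\<tau>} (\<lambda>s. X s - X' s)" "continuous_on {0..\<tau>} (\<lambda>s. V s - V' s)"
      using \<tau> by (auto intro!: continuous_intros continuous_on_subset[OF r(1)] continuous_on_subset[OF r(2)]
        continuous_on_subset[OF r'(1)] continuous_on_subset[OF r'(2)])
    show "X 0 - X' 0 = 0" "V 0 - V' 0 = 0"
      using sol by (auto simp: particle_solution_def X_def X'_def V_def V'_def)
    show "0 \<le> c" "0 \<le> \<delta>" using c0 by (auto simp: \<delta>_def)
    fix s assume s: "0 < s" "s < \<tau>"
    then have sT: "s < T" using \<tau> by simp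
    show "((\<lambda>s. X s - X' s) has_vector_derivative V s - V' s) (at s)"
      by (intro has_vector_derivative_diff r(3) r'(3) s sT)
    have "((\<lambda>s. V s - V' s) has_vector_derivative
        (V s \<times> b s + E (X s)) - (V' s \<times> b' s + E (X' s))) (at s)"
      using has_vector_derivative_diff[OF r(4)[OF s(1) sT] r'(4)[OF s(1) sT]] by (simp only: b_def b'_def)
    then show "((\<lambda>s. V s - V' s) has_vector_derivative (V s - V' s) \<times> b s + g s) (at s)"
      by (simp add: g_def Cross3.left_diff_distrib Cross3.right_diff_distrib algebra_simps)
    have XK: "norm (X s) \<le> K" "norm (X' s) \<le> K" "norm (V' s) \<le> K"
      using bound s sT pos by (auto simp: X_def X'_def V'_def divide_right_mono)
    have sc: "norm (\<epsilon> *\<^sub>R X s) \<le> K" "norm (\<epsilon>' *\<^sub>R X' s) \<le> K"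
      using XK \<epsilon> pos mult_left_le_one_le[of "norm (X s)" \<epsilon>] mult_left_le_one_le[of "norm (X' s)" \<epsilon>'] by auto
    define P where "P = norm (X s - X' s)"
    have P0: "0 \<le> P" and \<delta>0: "0 \<le> \<delta>" by (auto simp: P_def \<delta>_def)
    have i1: "\<bar>inverse \<epsilon> - inverse \<epsilon>'\<bar> \<le> \<delta> / e0\<^sup>2"
    proof -
      have "\<bar>inverse \<epsilon> - inverse \<epsilon>'\<bar> = \<delta> / (\<epsilon> * \<epsilon>')"
        using pos by (simp add: \<delta>_def inverse_diff_inverse abs_mult divide_simps abs_minus_commute)
      also have "\<dots> \<le> \<delta> / (e0 * e0)"
        using \<delta>0 \<epsilon> e0 pos by (intro divide_left_mono mult_mono) auto
      finally show ?thesis by (simp add: power2_eq_square)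
    qed
    have i2: "inverse \<epsilon>' \<le> 1 / e0" using \<epsilon> e0 by (simp add: divide_inverse)
    have "b s - b' s = (inverse \<epsilon> - inverse \<epsilon>') *\<^sub>R B (\<epsilon> *\<^sub>R X s) + inverse \<epsilon>' *\<^sub>R (B (\<epsilon> *\<^sub>R X s) - B (\<epsilon>' *\<^sub>R X' s))"
      by (simp add: b_def b'_def algebra_simps)
    then have "norm (b s - b' s) \<le> \<bar>inverse \<epsilon> - inverse \<epsilon>'\<bar> * norm (B (\<epsilon> *\<^sub>R X s))
        + \<bar>inverse \<epsilon>'\<bar> * norm (B (\<epsilon> *\<^sub>R X s) - B (\<epsilon>' *\<^sub>R X' s))"
      by (metis norm_scaleR norm_triangle_ineq)
    also have "\<dots> \<le> \<delta> / e0\<^sup>2 * L + 1 / e0 * (L * (\<delta> * K + P))"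
    proof (intro add_mono mult_mono)
      have "\<epsilon> *\<^sub>R X s - \<epsilon>' *\<^sub>R X' s = (\<epsilon> - \<epsilon>') *\<^sub>R X s + \<epsilon>' *\<^sub>R (X s - X' s)" by (simp add: algebra_simps)
      then have "norm (\<epsilon> *\<^sub>R X s - \<epsilon>' *\<^sub>R X' s) \<le> \<delta> * norm (X s) + \<bar>\<epsilon>'\<bar> * P"
        unfolding \<delta>_def P_def by (metis norm_scaleR norm_triangle_ineq)
      also have "\<dots> \<le> \<delta> * K + 1 * P" using XK \<epsilon> pos \<delta>0 P0 by (intro add_mono mult_mono) auto
      finally have "L * norm (\<epsilon> *\<^sub>R X s - \<epsilon>' *\<^sub>R X' s) \<le> L * (\<delta> * K + P)" using L by (intro mult_left_mono) auto
      then show "norm (B (\<epsilon> *\<^sub>R X s) - B (\<epsilon>' *\<^sub>R X' s)) \<le> L * (\<delta> * K + P)"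
        using B_lip[OF sc] by linarith
    qed (use i1 i2 B_bound[OF sc(1)] pos e0 \<delta>0 in auto)
    finally have bb: "norm (b s - b' s) \<le> \<delta> / e0\<^sup>2 * L + 1 / e0 * (L * (\<delta> * K + P))" .
    have "norm (g s) \<le> norm (V' s) * norm (b s - b' s) + L * P"
      unfolding g_def P_def by (intro norm_triangle_le add_mono norm_cross_le E_lip XK)
    also have "norm (V' s) * norm (b s - b' s) \<le> K * (\<delta> / e0\<^sup>2 * L + 1 / e0 * (L * (\<delta> * K + P)))"
      using XK bb L by (intro mult_mono) auto
    also have "\<dots> + L * P \<le> c * (\<delta> + P)"
    proof -
      have "0 \<le> K * (L / e0\<^sup>2) * P" "0 \<le> K * (L * K / e0) * P" "0 \<le> K * (L / e0) * \<delta>" "0 \<le> L * \<delta>"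
        using L e0 \<delta>0 P0 by auto
      then show ?thesis unfolding c_def by (simp add: algebra_simps add_divide_distrib)
    qed
    finally show "norm (g s) \<le> c * (\<delta> + norm (X s - X' s))" unfolding P_def by simp
  qed
  then show ?thesis by (simp add: X_def X'_def \<delta>_def)
qed

text \<open>For small \<open>\<epsilon>\<close> the field is close to \<open>B 0\<close>; the remaining \<open>\<epsilon>\<close> are bounded away from 0, and in the slow
  time \<open>\<tau> = \<epsilon> t\<close> the orbits depend continuously on \<open>(\<epsilon>, \<tau>)\<close> in a compact rectangle.\<close>

lemma field_bounded_below_on_orbits:
  fixes x v :: "real \<Rightarrow> real \<Rightarrow> real^3"
  assumes B: "C1 B" and E: "C1 E" and B0: "B 0 \<noteq> 0" and T: "0 < T" and K: "0 \<le> K"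
    and sol: "\<And>\<epsilon>. \<epsilon> \<in> {0<..1} \<Longrightarrow> particle_solution B E T \<epsilon> x0 v0 (x \<epsilon>) (v \<epsilon>)"
    and x_bound: "\<And>\<epsilon> t. \<epsilon> \<in> {0<..1} \<Longrightarrow> t \<in> {0..T/\<epsilon>} \<Longrightarrow> norm (x \<epsilon> t) \<le> K"
    and v_bound: "\<And>\<epsilon> t. \<epsilon> \<in> {0<..1} \<Longrightarrow> t \<in> {0..T/\<epsilon>} \<Longrightarrow> norm (v \<epsilon> t) \<le> K"
    and nonzero: "\<And>\<epsilon> t. \<epsilon> \<in> {0<..1} \<Longrightarrow> t \<in> {0..T/\<epsilon>} \<Longrightarrow> B (\<epsilon> *\<^sub>R x \<epsilon> t) \<noteq> 0"
  obtains c where "0 < c" "\<And>\<epsilon> t. \<epsilon> \<in> {0<..1} \<Longrightarrow> t \<in> {0..T/\<epsilon>} \<Longrightarrow> c \<le> norm (B (\<epsilon> *\<^sub>R x \<epsilon> t))"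
proof -
  obtain LB where LB: "0 \<le> LB" "\<And>y z. norm y \<le> K \<Longrightarrow> norm z \<le> K \<Longrightarrow> norm (B y - B z) \<le> LB * norm (y - z)"
    using C1_lipschitz_ball[OF B, of K] by blast
  obtain LE where LE: "0 \<le> LE" "\<And>y z. norm y \<le> K \<Longrightarrow> norm z \<le> K \<Longrightarrow> norm (E y - E z) \<le> LE * norm (y - z)"
    using C1_lipschitz_ball[OF E, of K] by blast
  define L where "L = LB + LE + norm (B 0) + LB * K"
  have L: "0 \<le> L" "LB \<le> L" "LE \<le> L" "norm (B 0) + LB * K \<le> L" using LB LE K by (auto simp: L_def)
  have lipB: "norm (B y - B z) \<le> L * norm (y - z)" if "norm y \<le> K" "norm z \<le> K" for y z
    using LB(2)[OF that] L(2) by (meson mult_right_mono norm_ge_zero order_trans)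
  have lipE: "norm (E y - E z) \<le> L * norm (y - z)" if "norm y \<le> K" "norm z \<le> K" for y z
    using LE(2)[OF that] L(3) by (meson mult_right_mono norm_ge_zero order_trans)
  have Bb: "norm (B y) \<le> L" if "norm y \<le> K" for y
  proof -
    have "norm (B y) \<le> norm (B 0) + norm (B y - B 0)" by (rule norm_triangle_sub)
    also have "norm (B y - B 0) \<le> LB * norm y" using LB(2)[of y 0] that K by simp
    also have "LB * norm y \<le> LB * K" using that LB(1) by (intro mult_left_mono)
    finally show ?thesis using L by simp
  qed
  have "0 < norm (B 0)" "0 \<le> LB * K" using B0 LB(1) K by auto
  then have L0: "0 < L" using L(4) by linarith
  define e0 where "e0 = min 1 (norm (B 0) / (2 * L * (K + 1)))"
  have e0: "0 < e0" "e0 \<le> 1" using B0 L0 K by (auto simp: e0_def)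
  have small: "norm (B 0) / 2 \<le> norm (B (\<epsilon> *\<^sub>R x \<epsilon> t))" if e: "\<epsilon> \<in> {0<..1}" "\<epsilon> \<le> e0" and t: "t \<in> {0..T/\<epsilon>}" for \<epsilon> t
  proof -
    have "\<epsilon> * (2 * L * (K + 1)) \<le> norm (B 0)" using e L0 K by (simp add: e0_def pos_le_divide_eq)
    have "norm (\<epsilon> *\<^sub>R x \<epsilon> t) \<le> \<epsilon> * K" using e x_bound[OF e(1) t] by simp
    moreover have "\<epsilon> * K \<le> K" using e K by (simp add: mult_left_le_one_le)
    ultimately have "norm (B 0 - B (\<epsilon> *\<^sub>R x \<epsilon> t)) \<le> L * norm (\<epsilon> *\<^sub>R x \<epsilon> t)"
      using lipB[of 0 "\<epsilon> *\<^sub>R x \<epsilon> t"] K by simp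
    also have "\<dots> \<le> L * (\<epsilon> * K)" using L(1) \<open>norm (\<epsilon> *\<^sub>R x \<epsilon> t) \<le> \<epsilon> * K\<close> by (intro mult_left_mono)
    also have "\<dots> \<le> norm (B 0) / 2"
    proof -
      have "L * (\<epsilon> * K) \<le> L * (\<epsilon> * (K + 1))" using L e by (intro mult_left_mono) auto
      then show ?thesis using \<open>\<epsilon> * (2 * L * (K + 1)) \<le> norm (B 0)\<close> by (simp add: algebra_simps)
    qed
    finally show ?thesis using norm_triangle_sub[of "B 0" "B (\<epsilon> *\<^sub>R x \<epsilon> t)"] by simp
  qed
  define c where "c = K * (L / e0\<^sup>2 + L * K / e0 + L / e0) + L"
  define M where "M = exp ((1 + 2 * c) * T)"
  have c0: "0 \<le> c" using L K e0 by (auto simp: c_def)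
  have eps_lip: "norm (x \<epsilon> (\<tau> / \<epsilon>) - x \<epsilon>' (\<tau> / \<epsilon>')) \<le> M * \<bar>\<epsilon> - \<epsilon>'\<bar>"
    if "\<epsilon> \<in> {e0..1}" "\<epsilon>' \<in> {e0..1}" "\<tau> \<in> {0..T}" for \<epsilon> \<epsilon>' \<tau>
  proof -
    have "norm (x \<epsilon> (\<tau> / \<epsilon>) - x \<epsilon>' (\<tau> / \<epsilon>')) \<le> \<bar>\<epsilon> - \<epsilon>'\<bar> * exp ((1 + 2 * c) * \<tau>)"
      unfolding c_def
      by (rule solution_lipschitz_in_eps[OF sol sol, of \<epsilon> \<epsilon>' e0 K L \<tau>])
         (use that e0 K L x_bound v_bound Bb lipB lipE in auto)
    also have "\<dots> \<le> \<bar>\<epsilon> - \<epsilon>'\<bar> * M"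
      unfolding M_def using that c0 by (intro mult_left_mono) (simp_all add: mult_left_mono)
    finally show ?thesis by (simp add: mult.commute)
  qed
  define Q where "Q = Sigma {e0..1} (\<lambda>_. {0..T})"
  have Q: "compact Q" "Q \<noteq> {}" unfolding Q_def using e0 T by (auto intro!: compact_Times)
  define X where "X q = x (fst q) (snd q / fst q)" for q
  have "continuous_on Q X" unfolding continuous_on_def
  proof
    fix q assume q: "q \<in> Q"
    have "continuous_on {0..T} (\<lambda>s. x (fst q) (s / fst q))"
      using q e0 by (intro rescaled_solution(1)[OF sol]) (auto simp: Q_def)
    then have "continuous_on Q (\<lambda>p. x (fst q) (snd p / fst q))"
      by (rule continuous_on_compose2) (auto simp: Q_def intro!: continuous_intros)
    then have 1: "((\<lambda>p. x (fst q) (snd p / fst q)) \<longlongrightarrow> X q) (at q within Q)"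
      using q unfolding continuous_on_def X_def by blast
    have 2: "((\<lambda>p. X p - x (fst q) (snd p / fst q)) \<longlongrightarrow> 0) (at q within Q)"
    proof (rule Lim_null_comparison)
      show "\<forall>\<^sub>F p in at q within Q. norm (X p - x (fst q) (snd p / fst q)) \<le> M * \<bar>fst p - fst q\<bar>"
        unfolding eventually_at_filter using q
        by (intro always_eventually) (auto simp: X_def Q_def intro!: eps_lip)
      have "((\<lambda>p. M * \<bar>fst p - fst q\<bar>) \<longlongrightarrow> M * \<bar>fst q - fst q\<bar>) (at q within Q)"
        by (intro tendsto_intros)
      then show "((\<lambda>p. M * \<bar>fst p - fst q\<bar>) \<longlongrightarrow> 0) (at q within Q)" by simp
    qed
    from tendsto_add[OF 2 1] show "(X \<longlongrightarrow> X q) (at q within Q)" by simp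
  qed
  then have "continuous_on Q (\<lambda>q. norm (B (fst q *\<^sub>R X q)))"
    by (intro continuous_intros continuous_on_compose2[OF C1_continuous[OF B]]) auto
  then obtain q where q: "q \<in> Q" and qmin: "\<And>p. p \<in> Q \<Longrightarrow> norm (B (fst q *\<^sub>R X q)) \<le> norm (B (fst p *\<^sub>R X p))"
    using continuous_attains_inf[OF Q] by blast
  have "B (fst q *\<^sub>R X q) \<noteq> 0"
    using q e0 unfolding X_def Q_def by (intro nonzero) (auto simp: divide_right_mono)
  then have pos: "0 < min (norm (B 0) / 2) (norm (B (fst q *\<^sub>R X q)))" using B0 by simp
  show ?thesis
  proof (rule that[OF pos])
    fix \<epsilon> t assume e: "\<epsilon> \<in> {0<..1::real}" and t: "t \<in> {0..T/\<epsilon>}"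
    show "min (norm (B 0) / 2) (norm (B (fst q *\<^sub>R X q))) \<le> norm (B (\<epsilon> *\<^sub>R x \<epsilon> t))"
    proof (cases "\<epsilon> \<le> e0")
      case True then show ?thesis using small[OF e _ t] by simp
    next
      case False
      then have "(\<epsilon>, \<epsilon> * t) \<in> Q" using e t by (auto simp: Q_def field_simps)
      from qmin[OF this] show ?thesis using e by (simp add: X_def)
    qed
  qed
qed

lemma gyro_flow_of_particle_solution:
  assumes sol: "particle_solution B E T \<epsilon> x0 v0 x v" and \<epsilon>: "0 < \<epsilon>" "\<epsilon> \<le> 1"
    and "0 < r" "K + 1 + r \<le> \<Lambda>" "1 \<le> \<Lambda>"
    and "\<And>y z. norm y \<le> K + 1 + r \<Longrightarrow> norm z \<le> K + 1 + r \<Longrightarrow> norm (B y - B z) \<le> \<Lambda> * norm (y - z)"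
    and "\<And>y z. norm y \<le> K + 1 + r \<Longrightarrow> norm z \<le> K + 1 + r \<Longrightarrow> norm (E y - E z) \<le> \<Lambda> * norm (y - z)"
    and "\<And>y. norm y \<le> K + 1 + r \<Longrightarrow> norm (E y) \<le> \<Lambda>"
    and "C1 E" "B 0 \<noteq> 0"
    and "\<And>t. t \<in> {0..T/\<epsilon>} \<Longrightarrow> norm (x t) \<le> K" "\<And>t. t \<in> {0..T/\<epsilon>} \<Longrightarrow> norm (v t) \<le> K"
  shows "gyro_flow B E x v \<epsilon> (T / \<epsilon>) K r \<Lambda>"
proof
  show "continuous_on UNIV E" by (rule C1_continuous) fact
  show "continuous_on {0..T / \<epsilon>} x" "continuous_on {0..T / \<epsilon>} v"
    using sol by (auto simp: particle_solution_def)
qed (use assms particle_solution_deriv[OF sol] in auto)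

lemma numerical_solution_iff_steps:
  assumes "gyro_flow B E x v \<epsilon> (T / \<epsilon>) K r \<Lambda>"
  shows "S1_AVF_numerical_solution r B E T \<epsilon> h x0 v0 xs vs \<longleftrightarrow>
    xs 0 = x0 \<and> vs 0 = v0 \<and>
    (\<forall>n. real (Suc n) * h \<le> T / \<epsilon> \<longrightarrow> gyro_flow.step B E \<epsilon> r h (xs n, vs n) (xs (Suc n), vs (Suc n)))"
  unfolding S1_AVF_numerical_solution_def S1_AVF_def mat_exp_hat gyro_flow.step_def[OF assms] fst_conv snd_conv
  by blast

unbundle no cross3_syntax

theorem theorem3p1:
  fixes B E :: "real^3 \<Rightarrow> real^3" and U :: "real^3 \<Rightarrow> real"
    and x0 v0 :: "real^3" and T r :: real
    and x v :: "real \<Rightarrow> real \<Rightarrow> real^3"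
  assumes B_C1: "C1 B" and E_C1: "C1 E"
    and E_grad: "\<And>y. GDERIV U y :> - E y"
    and B0: "norm (B 0) > 0"
    and T_pos: "T > 0"
    and sol: "\<And>\<epsilon>. \<epsilon> \<in> {0<..1} \<Longrightarrow> particle_solution B E T \<epsilon> x0 v0 (x \<epsilon>) (v \<epsilon>)"
    and bounded: "\<exists>K. \<forall>\<epsilon>\<in>{0<..1}. \<forall>s\<in>{0..T/\<epsilon>}. \<forall>t\<in>{0..T/\<epsilon>}.
                    norm (x \<epsilon> s) + norm (v \<epsilon> t) \<le> K"
    and r_pos: "r > 0"
  shows "\<exists>N0::nat. N0 > 0 \<and>
    (\<forall>\<epsilon>\<in>{0<..1}. \<forall>N\<ge>N0.
       \<exists>xs vs. S1_AVF_numerical_solution r B E T \<epsilon> (gyro_period B / real N) x0 v0 xs vs) \<and>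
    (\<forall>m0::real. m0 > 0 \<longrightarrow>
      (\<exists>C>0. \<forall>\<epsilon>\<in>{0<..1}. \<forall>N\<ge>N0. \<forall>h xs vs.
         h = gyro_period B / real N \<longrightarrow>
         S1_AVF_numerical_solution r B E T \<epsilon> h x0 v0 xs vs \<longrightarrow>
         (\<forall>n. real n * h \<le> T/\<epsilon> \<longrightarrow>
            norm (xs n - x \<epsilon> (real n * h)) \<le> C * (\<epsilon> * h + real N powr (- m0)) \<and>
            ((\<forall>\<delta>\<in>{0<..1}. \<forall>t\<in>{0..T/\<delta>}. B (\<delta> *\<^sub>R x \<delta> t) \<noteq> 0) \<longrightarrow>
               norm (v_par B \<epsilon> (xs n) (vs n) - v_par B \<epsilon> (x \<epsilon> (real n * h)) (v \<epsilon> (real n * h)))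
                 \<le> C * (\<epsilon> * h + real N powr (- m0))))))"
proof -
  obtain K where "\<forall>\<epsilon>\<in>{0<..1}. \<forall>s\<in>{0..T/\<epsilon>}. \<forall>t\<in>{0..T/\<epsilon>}. norm (x \<epsilon> s) + norm (v \<epsilon> t) \<le> K"
    using bounded by blast
  then have Kb: "norm (x \<epsilon> t) + norm (v \<epsilon> t) \<le> K" if "\<epsilon> \<in> {0<..1}" "t \<in> {0..T/\<epsilon>}" for \<epsilon> t
    using that by blast
  have xb: "norm (x \<epsilon> t) \<le> K" and vb: "norm (v \<epsilon> t) \<le> K" if "\<epsilon> \<in> {0<..1}" "t \<in> {0..T/\<epsilon>}" for \<epsilon> t
    using Kb[OF that] norm_ge_zero[of "x \<epsilon> t"] norm_ge_zero[of "v \<epsilon> t"] by linarith+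
  have "norm (x 1 0) \<le> K" using xb[of 1 0] T_pos by simp
  then have K0: "0 \<le> K" using norm_ge_zero order_trans by blast
  define R where "R = K + 1 + r"
  have R: "0 \<le> R" using K0 r_pos by (simp add: R_def)
  obtain LB where LB: "0 \<le> LB" "\<And>y z. norm y \<le> R \<Longrightarrow> norm z \<le> R \<Longrightarrow> norm (B y - B z) \<le> LB * norm (y - z)"
    using C1_lipschitz_ball[OF B_C1, of R] by blast
  obtain LE where LE: "0 \<le> LE" "\<And>y z. norm y \<le> R \<Longrightarrow> norm z \<le> R \<Longrightarrow> norm (E y - E z) \<le> LE * norm (y - z)"
    using C1_lipschitz_ball[OF E_C1, of R] by blast
  define \<Lambda> where "\<Lambda> = R + LB + LE + (norm (E 0) + LE * R)"
  have \<Lambda>: "1 \<le> \<Lambda>" "R \<le> \<Lambda>" "LB \<le> \<Lambda>" "LE \<le> \<Lambda>" "norm (E 0) + LE * R \<le> \<Lambda>"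
    using LB LE R K0 r_pos by (auto simp: \<Lambda>_def R_def add_nonneg_nonneg intro!: add_increasing2)
  have B_lip: "norm (B y - B z) \<le> \<Lambda> * norm (y - z)" if "norm y \<le> R" "norm z \<le> R" for y z
    using LB(2)[OF that] \<Lambda>(3) by (meson mult_right_mono norm_ge_zero order_trans)
  have E_lip: "norm (E y - E z) \<le> \<Lambda> * norm (y - z)" if "norm y \<le> R" "norm z \<le> R" for y z
    using LE(2)[OF that] \<Lambda>(4) by (meson mult_right_mono norm_ge_zero order_trans)
  have E_bound: "norm (E y) \<le> \<Lambda>" if "norm y \<le> R" for y
  proof -
    have "norm (E y) \<le> norm (E 0) + norm (E y - E 0)" by (rule norm_triangle_sub)
    also have "norm (E y - E 0) \<le> LE * norm y" using LE(2)[of y 0] that R by simp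
    also have "LE * norm y \<le> LE * R" using that LE by (intro mult_left_mono)
    finally show ?thesis using \<Lambda> by simp
  qed
  have flow: "gyro_flow B E (x \<epsilon>) (v \<epsilon>) \<epsilon> (T / \<epsilon>) K r \<Lambda>" if "\<epsilon> \<in> {0<..1}" for \<epsilon>
    using that sol[OF that] r_pos \<Lambda> B_lip E_lip E_bound E_C1 B0 xb[OF that] vb[OF that]
    by (intro gyro_flow_of_particle_solution[where ?x0.0 = x0 and ?v0.0 = v0]) (auto simp: R_def)
  define C0 where "C0 = exp (5 * \<Lambda>\<^sup>2 * T) * (4 * \<Lambda> + 37 * \<Lambda>^3 * T) + 2 * \<Lambda>"
  have C0: "gyro_flow.err_const \<epsilon> (T / \<epsilon>) \<Lambda> = C0" if "\<epsilon> \<in> {0<..1}" for \<epsilon>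
    using that by (simp add: gyro_flow.err_const_def[OF flow[OF that]] C0_def)
  have C0_pos: "0 < C0" using \<Lambda> T_pos by (auto simp: C0_def intro!: add_nonneg_pos mult_nonneg_nonneg)
  define h0 where "h0 = min (min 1 (2 / norm (B 0))) (min (1 / C0) (r / (2 * \<Lambda>)))"
  have h0: "0 < h0" using B0 C0_pos r_pos \<Lambda> by (simp add: h0_def)
  have P0: "0 < gyro_period B" using B0 by (simp add: gyro_period_def)
  obtain N0 :: nat where N0: "gyro_period B / h0 < real N0" using reals_Archimedean2 by blast
  have N0_pos: "0 < N0" using N0 P0 h0 by (metis divide_pos_pos of_nat_0_less_iff order.strict_trans)
  have hsmall: "0 < h" "h \<le> 1" "h * norm (B 0) \<le> 2" "C0 * h \<le> 1" "2 * \<Lambda> * h \<le> r"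
    if N: "N0 \<le> N" and hN: "h = gyro_period B / real N" for N h
  proof -
    have "gyro_period B / h0 < real N" using N0 N by linarith
    then have "gyro_period B < h0 * real N" using h0 by (simp add: pos_divide_less_eq mult.commute)
    then have "h \<le> h0" using N N0_pos hN by (simp add: divide_le_eq)
    then have "h \<le> 1" "h \<le> 2 / norm (B 0)" "h \<le> 1 / C0" "h \<le> r / (2 * \<Lambda>)" by (auto simp: h0_def)
    then show "h \<le> 1" "h * norm (B 0) \<le> 2" "C0 * h \<le> 1" "2 * \<Lambda> * h \<le> r"
      using B0 C0_pos \<Lambda> by (auto simp: pos_le_divide_eq mult.commute)
    show "0 < h" using P0 N N0_pos hN by simp
  qed
  have ex: "\<exists>xs vs. S1_AVF_numerical_solution r B E T \<epsilon> (gyro_period B / real N) x0 v0 xs vs"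
    if e: "\<epsilon> \<in> {0<..1}" and N: "N0 \<le> N" for \<epsilon> N
  proof -
    note hs = hsmall[OF N refl]
    obtain p where p: "p 0 = (x \<epsilon> 0, v \<epsilon> 0)"
      "\<And>n. real (Suc n) * (gyro_period B / real N) \<le> T / \<epsilon> \<Longrightarrow>
        gyro_flow.step B E \<epsilon> r (gyro_period B / real N) (p n) (p (Suc n))"
      using gyro_flow.steps_exist[OF flow[OF e] hs(1-3) _ hs(5)] hs(4) C0[OF e] by metis
    have "x \<epsilon> 0 = x0" "v \<epsilon> 0 = v0" using sol[OF e] by (auto simp: particle_solution_def)
    with p have "S1_AVF_numerical_solution r B E T \<epsilon> (gyro_period B / real N) x0 v0 (fst \<circ> p) (snd \<circ> p)"
      unfolding numerical_solution_iff_steps[OF flow[OF e]] by simp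
    then show ?thesis by blast
  qed
  have err: "norm (xs n - x \<epsilon> (real n * h)) \<le> C0 * (\<epsilon> * h)" "norm (vs n - v \<epsilon> (real n * h)) \<le> C0 * (\<epsilon> * h)"
      "norm (xs n) \<le> K + 1" "norm (vs n) \<le> K + 1"
    if e: "\<epsilon> \<in> {0<..1}" and N: "N0 \<le> N" and hN: "h = gyro_period B / real N"
      and num: "S1_AVF_numerical_solution r B E T \<epsilon> h x0 v0 xs vs" and n: "real n * h \<le> T / \<epsilon>" for \<epsilon> N h xs vs n
  proof -
    note hs = hsmall[OF N hN]
    note steps = num[unfolded numerical_solution_iff_steps[OF flow[OF e]]]
    have i: "x \<epsilon> 0 = x0" "v \<epsilon> 0 = v0" using sol[OF e] by (auto simp: particle_solution_def)
    have "real (Suc k) * h \<le> T / \<epsilon>" if "k < n" for k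
    proof -
      have "real (Suc k) * h \<le> real n * h" using that hs by (intro mult_right_mono) auto
      with n show ?thesis by linarith
    qed
    then have st: "gyro_flow.step B E \<epsilon> r h (xs k, vs k) (xs (Suc k), vs (Suc k))" if "k < n" for k
      using steps that by blast
    from gyro_flow.error_bound[OF flow[OF e] hs(1-3), of "\<lambda>k. (xs k, vs k)" n] hs(4) C0[OF e] steps i n st
    show "norm (xs n - x \<epsilon> (real n * h)) \<le> C0 * (\<epsilon> * h)" "norm (vs n - v \<epsilon> (real n * h)) \<le> C0 * (\<epsilon> * h)"
      "norm (xs n) \<le> K + 1" "norm (vs n) \<le> K + 1" by auto
  qed
  define nonzero where "nonzero \<longleftrightarrow> (\<forall>\<delta>\<in>{0<..1}. \<forall>t\<in>{0..T/\<delta>}. B (\<delta> *\<^sub>R x \<delta> t) \<noteq> 0)"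
  obtain c where c: "0 < c" and cB: "\<And>\<epsilon> t. nonzero \<Longrightarrow> \<epsilon> \<in> {0<..1} \<Longrightarrow> t \<in> {0..T/\<epsilon>} \<Longrightarrow> c \<le> norm (B (\<epsilon> *\<^sub>R x \<epsilon> t))"
  proof (cases nonzero)
    case True
    then show ?thesis
      using field_bounded_below_on_orbits[OF B_C1 E_C1 _ T_pos K0 sol xb vb] B0 that unfolding nonzero_def
      by (metis zero_less_norm_iff)
  next
    case False
    then show ?thesis using that[of 1] by simp
  qed
  define C where "C = (4 * \<Lambda> / c * \<Lambda> + 1) * C0"
  have C: "C0 \<le> C" "0 < C" using c \<Lambda> C0_pos by (auto simp: C_def mult_le_cancel_right1 intro!: mult_pos_pos add_nonneg_pos)
  have par: "norm (v_par B \<epsilon> (xs n) (vs n) - v_par B \<epsilon> (x \<epsilon> (real n * h)) (v \<epsilon> (real n * h))) \<le> C * (\<epsilon> * h)"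
    if nz: nonzero and e: "\<epsilon> \<in> {0<..1}" and N: "N0 \<le> N" and hN: "h = gyro_period B / real N"
      and num: "S1_AVF_numerical_solution r B E T \<epsilon> h x0 v0 xs vs" and n: "real n * h \<le> T / \<epsilon>" for \<epsilon> N h xs vs n
  proof -
    note er = err[OF e N hN num n]
    have t: "real n * h \<in> {0..T/\<epsilon>}" using n hsmall[OF N hN] by simp
    define d where "d = norm (B (\<epsilon> *\<^sub>R xs n) - B (\<epsilon> *\<^sub>R x \<epsilon> (real n * h)))"
    have xR: "norm (xs n) \<le> K + 1 + r" "norm (x \<epsilon> (real n * h)) \<le> K + 1 + r"
      using er xb[OF e t] r_pos by auto
    have "d \<le> \<Lambda> * (\<epsilon> * norm (xs n - x \<epsilon> (real n * h)))"
      unfolding d_def by (rule gyro_flow.B_lip_scaled[OF flow[OF e] xR])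
    also have "\<dots> \<le> \<Lambda> * (1 * (C0 * (\<epsilon> * h)))"
      using er e \<Lambda> by (intro mult_left_mono mult_mono) auto
    finally have d: "d \<le> \<Lambda> * (C0 * (\<epsilon> * h))" by simp
    have "norm (v_par B \<epsilon> (xs n) (vs n) - v_par B \<epsilon> (x \<epsilon> (real n * h)) (v \<epsilon> (real n * h)))
      \<le> 4 * norm (vs n) / c * d + norm (vs n - v \<epsilon> (real n * h))"
      unfolding d_def by (intro norm_v_par_diff_le c cB nz e t)
    also have "\<dots> \<le> 4 * \<Lambda> / c * (\<Lambda> * (C0 * (\<epsilon> * h))) + C0 * (\<epsilon> * h)"
      using d er c \<Lambda> r_pos
      by (intro add_mono mult_mono divide_right_mono) (auto simp: R_def d_def)
    also have "\<dots> = C * (\<epsilon> * h)" by (simp add: C_def algebra_simps)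
    finally show ?thesis .
  qed
  show ?thesis
  proof (intro exI[of _ N0] conjI allI impI ballI)
    show "0 < N0" by (rule N0_pos)
    show "\<exists>xs vs. S1_AVF_numerical_solution r B E T \<epsilon> (gyro_period B / real N) x0 v0 xs vs"
      if "\<epsilon> \<in> {0<..1}" "N0 \<le> N" for \<epsilon> N using ex that .
    fix m0 :: real assume "0 < m0"
    have weaken: "a \<le> C * (\<epsilon> * h + real N powr (- m0))" if "a \<le> C * (\<epsilon> * h)" for a \<epsilon> h :: real and N :: nat
    proof -
      have "C * (\<epsilon> * h) \<le> C * (\<epsilon> * h + real N powr (- m0))" using C by (intro mult_left_mono) auto
      with that show ?thesis by linarith
    qed
    show "\<exists>C>0. \<forall>\<epsilon>\<in>{0<..1}. \<forall>N\<ge>N0. \<forall>h xs vs.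
         h = gyro_period B / real N \<longrightarrow>
         S1_AVF_numerical_solution r B E T \<epsilon> h x0 v0 xs vs \<longrightarrow>
         (\<forall>n. real n * h \<le> T/\<epsilon> \<longrightarrow>
            norm (xs n - x \<epsilon> (real n * h)) \<le> C * (\<epsilon> * h + real N powr (- m0)) \<and>
            ((\<forall>\<delta>\<in>{0<..1}. \<forall>t\<in>{0..T/\<delta>}. B (\<delta> *\<^sub>R x \<delta> t) \<noteq> 0) \<longrightarrow>
               norm (v_par B \<epsilon> (xs n) (vs n) - v_par B \<epsilon> (x \<epsilon> (real n * h)) (v \<epsilon> (real n * h)))
                 \<le> C * (\<epsilon> * h + real N powr (- m0))))"
    proof (intro exI[of _ C] conjI allI impI ballI)
      show "0 < C" by (rule C)
      fix \<epsilon> N h xs vs n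
      assume a: "\<epsilon> \<in> {0<..1}" "N0 \<le> N" "h = gyro_period B / real N"
        "S1_AVF_numerical_solution r B E T \<epsilon> h x0 v0 xs vs" "real n * h \<le> T / \<epsilon>"
      have "C0 * (\<epsilon> * h) \<le> C * (\<epsilon> * h)"
        using C a(1) hsmall[OF a(2,3)] by (intro mult_right_mono) auto
      then show "norm (xs n - x \<epsilon> (real n * h)) \<le> C * (\<epsilon> * h + real N powr (- m0))"
        using err(1)[OF a] by (intro weaken) linarith
      assume "\<forall>\<delta>\<in>{0<..1}. \<forall>t\<in>{0..T/\<delta>}. B (\<delta> *\<^sub>R x \<delta> t) \<noteq> 0"
      then show "norm (v_par B \<epsilon> (xs n) (vs n) - v_par B \<epsilon> (x \<epsilon> (real n * h)) (v \<epsilon> (real n * h)))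
                 \<le> C * (\<epsilon> * h + real N powr (- m0))"
        using par[OF _ a] by (intro weaken) (simp add: nonzero_def)
    qed
  qed
qed

end
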